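(* Let $K$ be a field, $S=K[x_1,\dots,x_m,y_1,\dots,y_n]$ the standard bigraded polynomial ring, $Q=(y_1,\dots,y_n)$, and let $R=S/fS$ be a hypersurface ring, where $f\in S$ is a bihomogeneous form of degree $(a,b)$. Then $H^{n-1}_Q(R)$ is not finitely generated for $n\ge 2$.
   Context: The bigrading on $S$ is given by $\deg x_i=(1,0)$ and $\deg y_j=(0,1)$. $H^i_Q$ denotes the $i$-th local cohomology functor with support in $Q$; finite generation is as an $S$-module.
   Formalization: The form f is assumed nonzero with y-degree b ≥ 1; for f = 0 or b = 0 (e.g. f = x_1) the module H^{n-1}_Q(R) is zero, hence finitely generated, so the claim fails there. *)

theory Defs
  imports "HOL-Library.Poly_Mapping" "HOL-Library.Cardinality"
    "HOL-Algebra.QuotRing" "HOL-Algebra.Ideal_Product" "HOL-Algebra.Module"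
begin

section \<open>The standard bigraded polynomial ring\<close>

text \<open>
  The variables \<open>x\<^sub>i\<close> and \<open>y\<^sub>j\<close> are indexed by finite types \<open>'m\<close> and \<open>'n\<close>. A monomial is an
  exponent function on \<open>'m + 'n\<close>, where \<open>Inl i\<close> stands for \<open>x\<^sub>i\<close> and \<open>Inr j\<close> for \<open>y\<^sub>j\<close>; the
  multiplication of the type class on \<open>_ \<Rightarrow>\<^sub>0 _\<close> is the convolution product.
\<close>

type_synonym ('m, 'n) bimonom = "('m + 'n) \<Rightarrow>\<^sub>0 nat"
type_synonym ('m, 'n, 'k) bipoly = "('m, 'n) bimonom \<Rightarrow>\<^sub>0 'k"

definition bipoly_ring :: "('m::finite, 'n::finite, 'k::field) bipoly ring" where
  "bipoly_ring = \<lparr>carrier = UNIV, mult = (*), one = 1, zero = 0, add = (+)\<rparr>"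

definition y_var :: "'n \<Rightarrow> ('m::finite, 'n::finite, 'k::field) bipoly" where
  "y_var j = Poly_Mapping.single (Poly_Mapping.single (Inr j) 1) 1"

definition y_ideal :: "('m::finite, 'n::finite, 'k::field) bipoly set" where
  "y_ideal = Idl\<^bsub>bipoly_ring\<^esub> (range y_var)"

definition bidegree :: "('m::finite, 'n::finite) bimonom \<Rightarrow> nat \<times> nat" where
  "bidegree t = (\<Sum>i\<in>UNIV. Poly_Mapping.lookup t (Inl i), \<Sum>j\<in>UNIV. Poly_Mapping.lookup t (Inr j))"

text \<open>As usual for graded components, \<open>0\<close> is bihomogeneous of every bidegree.\<close>

definition bihomogeneous :: "nat \<times> nat \<Rightarrow> ('m::finite, 'n::finite, 'k::field) bipoly \<Rightarrow> bool" where
  "bihomogeneous d f \<longleftrightarrow> (\<forall>t\<in>Poly_Mapping.keys f. bidegree t = d)"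


section \<open>Modules over a commutative ring\<close>

text \<open>
  Records of type \<open>module\<close> carry the ring operations \<open>mult\<close> and \<open>one\<close>, which play no role for
  modules; they are left \<open>undefined\<close> below where they have no meaning.
\<close>

definition module_maps ::
    "('a, 'c) ring_scheme \<Rightarrow> ('a, 'b, 'x) module_scheme \<Rightarrow> ('a, 'e, 'y) module_scheme \<Rightarrow> ('b \<Rightarrow> 'e) set"
where
  "module_maps R M N = {h \<in> carrier M \<rightarrow> carrier N.
     (\<forall>x\<in>carrier M. \<forall>y\<in>carrier M. h (x \<oplus>\<^bsub>M\<^esub> y) = h x \<oplus>\<^bsub>N\<^esub> h y) \<and>
     (\<forall>r\<in>carrier R. \<forall>x\<in>carrier M. h (r \<odot>\<^bsub>M\<^esub> x) = r \<odot>\<^bsub>N\<^esub> h x)}"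

definition quot_module :: "('a, 'b, 'x) module_scheme \<Rightarrow> 'b set \<Rightarrow> ('a, 'b set) module" where
  "quot_module M N =
     \<lparr>carrier = a_rcosets\<^bsub>M\<^esub> N, mult = undefined, one = undefined, zero = N, add = set_add M,
      smult = (\<lambda>r X. \<Union>x\<in>X. N +>\<^bsub>M\<^esub> (r \<odot>\<^bsub>M\<^esub> x))\<rparr>"

definition quot_ring_module :: "('a, 'c) ring_scheme \<Rightarrow> 'a set \<Rightarrow> ('a, 'a set) module" where
  "quot_ring_module R I =
     ring.extend (R Quot I) \<lparr>smult = (\<lambda>r X. (I +>\<^bsub>R\<^esub> r) \<otimes>\<^bsub>R Quot I\<^esub> X)\<rparr>"

definition finitely_generated :: "('a, 'c) ring_scheme \<Rightarrow> ('a, 'b, 'x) module_scheme \<Rightarrow> bool" where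
  "finitely_generated R M \<longleftrightarrow>
     (\<exists>A. finite A \<and> A \<subseteq> carrier M \<and> (\<forall>N. submodule N R M \<and> A \<subseteq> N \<longrightarrow> N = carrier M))"

text \<open>
  The lifting property is tested on all modules \<open>B\<close> whose underlying set lies in the type of the
  elements of \<open>R\<close>, since a formula cannot quantify over types. This is no restriction: with \<open>B\<close>
  ranging over \<open>R\<close> and \<open>A\<close> over the ideals of \<open>R\<close>, it contains Baer's criterion, and so it
  implies the lifting property for modules over arbitrary types.
\<close>

definition injective_module :: "('a, 'c) ring_scheme \<Rightarrow> ('a, 'e, 'x) module_scheme \<Rightarrow> bool" where
  "injective_module R E \<longleftrightarrow> module R E \<and>
     (\<forall>(B :: ('a, 'a) module) A. module R B \<longrightarrow> submodule A R B \<longrightarrow>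
        (\<forall>h\<in>module_maps R (B\<lparr>carrier := A\<rparr>) E. \<exists>g\<in>module_maps R B E. \<forall>x\<in>A. g x = h x))"

text \<open>\<open>0 \<rightarrow> M \<rightarrow> E 0 \<rightarrow> E 1 \<rightarrow> \<dots>\<close> is exact, with augmentation \<open>\<epsilon>\<close> and differentials
  \<open>d i : E i \<rightarrow> E (i + 1)\<close>.\<close>

definition injective_resolution ::
    "('a, 'c) ring_scheme \<Rightarrow> ('a, 'b, 'x) module_scheme \<Rightarrow> ('b \<Rightarrow> 'e) \<Rightarrow>
     (nat \<Rightarrow> ('a, 'e) module) \<Rightarrow> (nat \<Rightarrow> 'e \<Rightarrow> 'e) \<Rightarrow> bool"
where
  "injective_resolution R M \<epsilon> E d \<longleftrightarrow>
     module R M \<and>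
     (\<forall>i. injective_module R (E i)) \<and>
     (\<forall>i. d i \<in> module_maps R (E i) (E (Suc i))) \<and>
     \<epsilon> \<in> module_maps R M (E 0) \<and>
     inj_on \<epsilon> (carrier M) \<and>
     \<epsilon> ` carrier M = a_kernel (E 0) (E 1) (d 0) \<and>
     (\<forall>i. d i ` carrier (E i) = a_kernel (E (Suc i)) (E (Suc (Suc i))) (d (Suc i)))"


section \<open>Local cohomology\<close>

text \<open>\<open>Q [^]\<^bsub>ideals_set R\<^esub> k\<close> is the \<open>k\<close>-th power of the ideal \<open>Q\<close>.\<close>

definition torsion :: "('a, 'c) ring_scheme \<Rightarrow> 'a set \<Rightarrow> ('a, 'b, 'x) module_scheme \<Rightarrow> 'b set" where
  "torsion R Q M =
     {x \<in> carrier M. \<exists>k::nat. \<forall>q \<in> Q [^]\<^bsub>ideals_set R\<^esub> k. q \<odot>\<^bsub>M\<^esub> x = \<zero>\<^bsub>M\<^esub>}"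

definition torsion_module ::
    "('a, 'c) ring_scheme \<Rightarrow> 'a set \<Rightarrow> ('a, 'b) module \<Rightarrow> ('a, 'b) module" where
  "torsion_module R Q M = M\<lparr>carrier := torsion R Q M\<rparr>"

text \<open>Cohomology of a cochain complex \<open>C 0 \<rightarrow> C 1 \<rightarrow> \<dots>\<close> of modules.\<close>

definition cohomology ::
    "(nat \<Rightarrow> ('a, 'b) module) \<Rightarrow> (nat \<Rightarrow> 'b \<Rightarrow> 'b) \<Rightarrow> nat \<Rightarrow> ('a, 'b set) module" where
  "cohomology C d i =
     quot_module ((C i)\<lparr>carrier := a_kernel (C i) (C (Suc i)) (d i)\<rparr>)
       (case i of 0 \<Rightarrow> {\<zero>\<^bsub>C 0\<^esub>} | Suc j \<Rightarrow> d j ` carrier (C j))"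

text \<open>
  The \<open>i\<close>-th right derived functor of \<open>Q\<close>-torsion at a module with injective resolution \<open>(E, d)\<close>.
  It does not depend on the resolution up to isomorphism, so statements about the local cohomology
  of a module are made for all of its injective resolutions.
\<close>

definition local_cohomology ::
    "('a, 'c) ring_scheme \<Rightarrow> 'a set \<Rightarrow> (nat \<Rightarrow> ('a, 'e) module) \<Rightarrow> (nat \<Rightarrow> 'e \<Rightarrow> 'e) \<Rightarrow> nat \<Rightarrow>
     ('a, 'e set) module" where
  "local_cohomology R Q E d i = cohomology (\<lambda>j. torsion_module R Q (E j)) d i"

end

theory Submission
  imports Defs
begin

text \<open>
  Write \<open>N = n - 1\<close> and \<open>R = S/fS\<close>. The sequence \<open>0 \<rightarrow> S \<rightarrow> S \<rightarrow> R \<rightarrow> 0\<close> identifies \<open>H\<^sup>N\<^sub>Q(R)\<close> with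
  the kernel of \<open>f\<close> on \<open>H\<^sup>n\<^sub>Q(S)\<close>, a module of inverse polynomials in which \<open>f\<close> has a large kernel.
  The proof makes this visible inside an arbitrary injective resolution \<open>E\<close> of \<open>R\<close>, without
  computing any local cohomology module.

  Every element of \<open>H\<^sup>N\<^sub>Q(R)\<close> is killed by a power of \<open>Q\<close>. If finitely many elements generate it, then
  for \<open>v \<in> Q\<close> one power \<open>v\<^sup>k\<close> kills all of it (\<open>local_cohomology_bound\<close>). It is enough to find a
  cohomology class that \<open>v\<^sup>k\<close> does not kill.

  Classes come from regular sequences. Let \<open>u\<^sub>0, u\<^sub>1, \<dots>\<close> be regular on \<open>S\<close>, and let \<open>A\<^sub>r\<close> be the
  subcomplex of \<open>E\<close> killed by \<open>u\<^sub>0, \<dots>, u\<^bsub>r-1\<^esub>\<close>, that is \<open>Hom(S/(u\<^sub>0, \<dots>, u\<^bsub>r-1\<^esub>), E)\<close>. Injectivity makes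
  \<open>u\<^sub>r\<close> surjective on \<open>A\<^sub>r\<close>, with kernel \<open>A\<^bsub>r+1\<^esub>\<close>. By induction on \<open>r\<close>, the cohomology of \<open>A\<^sub>r\<close> vanishes
  above degree \<open>r\<close> (\<open>cohomology_vanishes\<close>), and in degree \<open>r\<close> it is cyclic, isomorphic to
  \<open>S/(f, u\<^sub>0, \<dots>, u\<^bsub>r-1\<^esub>)\<close> (\<open>top_gen_generates\<close>, \<open>top_gen_bd_iff\<close>). Replacing each \<open>u\<^sub>i\<close> by a multiple \<open>t\<^sub>i u\<^sub>i\<close> embeds one complex into the other and
  multiplies the generator by \<open>\<Prod>t\<^sub>i\<close> (\<open>top_gen_transition\<close>). So questions about classes become
  questions about membership in ideals of \<open>S\<close> (\<open>uniform_power_imp_membership\<close>).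

  Number the \<open>y\<^sub>j\<close> from \<open>0\<close> to \<open>N\<close>. The sequence is \<open>v\<^sub>i = y\<^sub>i - c\<^sub>i y\<^sub>N\<close> for \<open>i < N\<close>, where \<open>c\<^sub>i\<close> is a power of one variable \<open>x\<close>. Since there is
  such a variable, the exponents can be chosen so that no two monomials of \<open>f\<close> collide under
  \<open>y\<^sub>i \<mapsto> c\<^sub>i y\<^sub>N\<close> (\<open>exists_shear\<close>). In the new coordinates \<open>f\<close> is therefore a form of degree \<open>b\<close> in
  \<open>v\<^sub>0, \<dots>, v\<^bsub>N-1\<^esub>, y\<^sub>N\<close> with a term \<open>F y\<^sub>N\<^sup>b\<close>, where \<open>0 \<noteq> F \<in> K[x\<^sub>1, \<dots>, x\<^sub>m]\<close>. Two consequences finish the proof.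

  First, \<open>F y\<^sub>N\<^sup>b\<close> is congruent modulo \<open>f\<close> to an element of \<open>(v\<^sub>0, \<dots>, v\<^bsub>N-1\<^esub>)\<close>. So a power \<open>g\<close> of \<open>F\<close> has a
  multiple \<open>y\<^sub>N\<^sup>M g\<close> in \<open>(f, v\<^sub>0\<^sup>k\<^sup>+\<^sup>1, \<dots>, v\<^bsub>N-1\<^esub>\<^sup>k\<^sup>+\<^sup>1)\<close> (\<open>lead_power_in_ideal\<close>), and \<open>g\<close> times the generator is
  cohomologous to a cocycle killed by a power of \<open>Q\<close>. Secondly, if \<open>v\<^sub>0\<^sup>k\<close> killed its class in \<open>H\<^sup>N\<^sub>Q(R)\<close>,
  then \<open>v\<^sub>0\<^sup>k g (v\<^sub>0 \<dots> v\<^bsub>N-1\<^esub>)\<^sup>l\<close> would lie in \<open>(f, v\<^sub>0\<^sup>l\<^sup>+\<^sup>k\<^sup>+\<^sup>1, \<dots>)\<close> for some \<open>l\<close>. Modulo the powers of the \<open>v\<^sub>i\<close> it is not zero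
  and has degree \<open>0\<close> in \<open>y\<^sub>N\<close>, whereas a multiple of \<open>f\<close> that is not zero there has degree at least \<open>b > 0\<close>
  (\<open>monomial_multiple_not_in_ideal\<close>). The condition \<open>n \<ge> 2\<close> provides \<open>v\<^sub>0\<close>.
\<close>

section \<open>Modules over a commutative ring given by a type class\<close>

text \<open>
  The structure of a type class ring as a record. Working with \<open>class_ring\<close> makes type class arithmetic
  available for the scalars, while modules keep explicit carriers.
\<close>

definition class_ring :: "'r::comm_ring_1 ring" where
  "class_ring = \<lparr>carrier = UNIV, mult = (*), one = 1, zero = 0, add = (+)\<rparr>"

lemma class_ring_simps [simp]:
  "carrier class_ring = UNIV" "mult class_ring = (*)" "one class_ring = 1"
  "zero class_ring = 0" "add class_ring = (+)"
  by (simp_all add: class_ring_def)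

lemma (in abelian_group) minus_eq_zero_iff:
  "\<lbrakk>x \<in> carrier G; y \<in> carrier G\<rbrakk> \<Longrightarrow> x \<ominus> y = \<zero> \<longleftrightarrow> x = y"
  by (metis a_minus_def a_inv_closed minus_equality minus_minus r_neg)

lemma (in abelian_group) add_minus_cancel:
  "\<lbrakk>x \<in> carrier G; y \<in> carrier G\<rbrakk> \<Longrightarrow> x \<oplus> (y \<ominus> x) = y"
  by (metis a_assoc a_comm a_inv_closed a_minus_def r_neg r_zero)

lemma (in abelian_group) add_minus_shift:
  "\<lbrakk>x \<in> carrier G; y \<in> carrier G; z \<in> carrier G; x = y \<oplus> z\<rbrakk> \<Longrightarrow> x \<ominus> y = z"
  by (metis a_assoc a_closed a_comm a_inv_closed a_minus_def r_neg r_zero)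

lemma cring_class_ring: "cring (class_ring :: 'r::comm_ring_1 ring)"
proof (rule cringI)
  show "abelian_group (class_ring :: 'r ring)"
    by (rule abelian_groupI) (auto simp: algebra_simps intro: exI[of _ "- x" for x])
  show "comm_monoid (class_ring :: 'r ring)"
    by (rule comm_monoidI) (auto simp: algebra_simps)
qed (auto simp: algebra_simps)

definition self_module :: "('r::comm_ring_1, 'r) module" where
  "self_module = \<lparr>carrier = UNIV, mult = (*), one = 1, zero = 0, add = (+), smult = (*)\<rparr>"

lemma self_module_simps [simp]:
  "carrier self_module = UNIV" "zero self_module = 0" "add self_module = (+)"
  "smult self_module = (*)"
  by (simp_all add: self_module_def)

lemma module_self_module: "module class_ring (self_module :: ('r::comm_ring_1, 'r) module)"
proof (rule moduleI)
  show "abelian_group (self_module :: ('r, 'r) module)"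
    by (rule abelian_groupI) (auto simp: algebra_simps intro: exI[of _ "- x" for x])
qed (auto simp: algebra_simps cring_class_ring)

lemma module_class_ringD:
  assumes "module (class_ring :: 'r::comm_ring_1 ring) M"
  shows "x \<in> carrier M \<Longrightarrow> r \<odot>\<^bsub>M\<^esub> x \<in> carrier M"
    and "x \<in> carrier M \<Longrightarrow> (r + s) \<odot>\<^bsub>M\<^esub> x = r \<odot>\<^bsub>M\<^esub> x \<oplus>\<^bsub>M\<^esub> s \<odot>\<^bsub>M\<^esub> x"
    and "\<lbrakk>x \<in> carrier M; y \<in> carrier M\<rbrakk> \<Longrightarrow> r \<odot>\<^bsub>M\<^esub> (x \<oplus>\<^bsub>M\<^esub> y) = r \<odot>\<^bsub>M\<^esub> x \<oplus>\<^bsub>M\<^esub> r \<odot>\<^bsub>M\<^esub> y"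
    and "\<lbrakk>x \<in> carrier M; y \<in> carrier M\<rbrakk> \<Longrightarrow> r \<odot>\<^bsub>M\<^esub> (x \<ominus>\<^bsub>M\<^esub> y) = r \<odot>\<^bsub>M\<^esub> x \<ominus>\<^bsub>M\<^esub> r \<odot>\<^bsub>M\<^esub> y"
    and "x \<in> carrier M \<Longrightarrow> (r - s) \<odot>\<^bsub>M\<^esub> x = r \<odot>\<^bsub>M\<^esub> x \<ominus>\<^bsub>M\<^esub> s \<odot>\<^bsub>M\<^esub> x"
    and "x \<in> carrier M \<Longrightarrow> (r * s) \<odot>\<^bsub>M\<^esub> x = r \<odot>\<^bsub>M\<^esub> (s \<odot>\<^bsub>M\<^esub> x)"
    and "x \<in> carrier M \<Longrightarrow> 1 \<odot>\<^bsub>M\<^esub> x = x"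
    and "x \<in> carrier M \<Longrightarrow> 0 \<odot>\<^bsub>M\<^esub> x = \<zero>\<^bsub>M\<^esub>"
    and "r \<odot>\<^bsub>M\<^esub> \<zero>\<^bsub>M\<^esub> = \<zero>\<^bsub>M\<^esub>"
proof -
  interpret module class_ring M by fact
  have neg: "\<ominus>\<^bsub>class_ring\<^esub> s = - s" for s :: 'r
    using R.minus_equality[of "- s" s] by simp
  show "x \<in> carrier M \<Longrightarrow> r \<odot>\<^bsub>M\<^esub> x \<in> carrier M"
    using smult_closed[of r x] by simp
  show "x \<in> carrier M \<Longrightarrow> (r + s) \<odot>\<^bsub>M\<^esub> x = r \<odot>\<^bsub>M\<^esub> x \<oplus>\<^bsub>M\<^esub> s \<odot>\<^bsub>M\<^esub> x"
    using smult_l_distr[of r s x] by simp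
  show "\<lbrakk>x \<in> carrier M; y \<in> carrier M\<rbrakk> \<Longrightarrow> r \<odot>\<^bsub>M\<^esub> (x \<oplus>\<^bsub>M\<^esub> y) = r \<odot>\<^bsub>M\<^esub> x \<oplus>\<^bsub>M\<^esub> r \<odot>\<^bsub>M\<^esub> y"
    using smult_r_distr[of r x y] by simp
  show "\<lbrakk>x \<in> carrier M; y \<in> carrier M\<rbrakk> \<Longrightarrow> r \<odot>\<^bsub>M\<^esub> (x \<ominus>\<^bsub>M\<^esub> y) = r \<odot>\<^bsub>M\<^esub> x \<ominus>\<^bsub>M\<^esub> r \<odot>\<^bsub>M\<^esub> y"
    using smult_r_distr[of r x "\<ominus>\<^bsub>M\<^esub> y"] smult_r_minus[of r y] by (simp add: a_minus_def)
  show "x \<in> carrier M \<Longrightarrow> (r - s) \<odot>\<^bsub>M\<^esub> x = r \<odot>\<^bsub>M\<^esub> x \<ominus>\<^bsub>M\<^esub> s \<odot>\<^bsub>M\<^esub> x"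
    using smult_l_distr[of r "- s" x] smult_l_minus[of s x] by (simp add: a_minus_def neg)
  show "x \<in> carrier M \<Longrightarrow> (r * s) \<odot>\<^bsub>M\<^esub> x = r \<odot>\<^bsub>M\<^esub> (s \<odot>\<^bsub>M\<^esub> x)"
    using smult_assoc1[of r s x] by simp
  show "x \<in> carrier M \<Longrightarrow> 1 \<odot>\<^bsub>M\<^esub> x = x" using smult_one[of x] by simp
  show "x \<in> carrier M \<Longrightarrow> 0 \<odot>\<^bsub>M\<^esub> x = \<zero>\<^bsub>M\<^esub>" using smult_l_null[of x] by simp
  show "r \<odot>\<^bsub>M\<^esub> \<zero>\<^bsub>M\<^esub> = \<zero>\<^bsub>M\<^esub>" using smult_r_null[of r] by simp
qed

text \<open>
  The ideal generated by the first \<open>r\<close> terms of \<open>u\<close>, with explicit coefficients, so that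
  ring homomorphisms can be applied to a membership.
\<close>

definition gen_ideal :: "(nat \<Rightarrow> 'r::comm_ring_1) \<Rightarrow> nat \<Rightarrow> 'r set" where
  "gen_ideal u r = {(\<Sum>i<r. c i * u i) | c. True}"

lemma gen_ideal_0 [simp]: "gen_ideal u 0 = {0}"
  by (simp add: gen_ideal_def)

lemma zero_in_gen_ideal: "0 \<in> gen_ideal u r"
  unfolding gen_ideal_def by (auto intro!: exI[of _ "\<lambda>_. 0"])

lemma gen_ideal_add: "\<lbrakk>p \<in> gen_ideal u r; q \<in> gen_ideal u r\<rbrakk> \<Longrightarrow> p + q \<in> gen_ideal u r"
proof -
  assume "p \<in> gen_ideal u r" "q \<in> gen_ideal u r"
  then obtain c c' where "p = (\<Sum>i<r. c i * u i)" "q = (\<Sum>i<r. c' i * u i)"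
    unfolding gen_ideal_def by blast
  hence "p + q = (\<Sum>i<r. (c i + c' i) * u i)" by (simp add: sum.distrib algebra_simps)
  thus ?thesis unfolding gen_ideal_def by (intro CollectI exI[of _ "\<lambda>i. c i + c' i"]) simp
qed

lemma gen_ideal_mult: "p \<in> gen_ideal u r \<Longrightarrow> s * p \<in> gen_ideal u r"
proof -
  assume "p \<in> gen_ideal u r"
  then obtain c where "p = (\<Sum>i<r. c i * u i)"
    unfolding gen_ideal_def by blast
  hence "s * p = (\<Sum>i<r. (s * c i) * u i)" by (simp add: sum_distrib_left mult.assoc)
  thus ?thesis unfolding gen_ideal_def by (intro CollectI exI[of _ "\<lambda>i. s * c i"]) simp
qed

lemma gen_ideal_Suc:
  "p \<in> gen_ideal u (Suc r) \<longleftrightarrow> (\<exists>q c. q \<in> gen_ideal u r \<and> p = q + c * u r)"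
proof
  assume "p \<in> gen_ideal u (Suc r)"
  then obtain c where "p = (\<Sum>i<Suc r. c i * u i)"
    unfolding gen_ideal_def by blast
  hence "p = (\<Sum>i<r. c i * u i) + c r * u r" by simp
  thus "\<exists>q c. q \<in> gen_ideal u r \<and> p = q + c * u r" unfolding gen_ideal_def by blast
next
  assume "\<exists>q c. q \<in> gen_ideal u r \<and> p = q + c * u r"
  then obtain c k where "p = (\<Sum>i<r. c i * u i) + k * u r" unfolding gen_ideal_def by blast
  hence "p = (\<Sum>i<Suc r. (c(r := k)) i * u i)" by simp
  thus "p \<in> gen_ideal u (Suc r)" unfolding gen_ideal_def by blast
qed

lemma gen_ideal_member: "j < r \<Longrightarrow> u j \<in> gen_ideal u r"
proof (induction r)
  case (Suc r)
  show ?case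
  proof (cases "j = r")
    case True
    thus ?thesis unfolding gen_ideal_Suc
      by (intro exI[of _ 0] exI[of _ 1]) (simp add: zero_in_gen_ideal)
  next
    case False
    with Suc show ?thesis unfolding gen_ideal_Suc
      by (intro exI[of _ "u j"] exI[of _ 0]) simp
  qed
qed simp

text \<open>
  Only the nonzerodivisor conditions; the ideal generated by \<open>u\<close> may be the whole ring, which allows
  exponents to be zero when powers are taken.
\<close>

definition regular_seq :: "(nat \<Rightarrow> 'r::comm_ring_1) \<Rightarrow> nat \<Rightarrow> bool" where
  "regular_seq u n \<longleftrightarrow> (\<forall>r<n. \<forall>s. u r * s \<in> gen_ideal u r \<longrightarrow> s \<in> gen_ideal u r)"

text \<open>
  If \<open>v\<close> is a nonzerodivisor modulo \<open>I\<close>, then multiplication by \<open>v\<close> is surjective on the \<open>I\<close>-torsion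
  \<open>Hom(S/I, E)\<close> of an injective module: the map \<open>v s + j \<mapsto> s e\<close> on the ideal \<open>(v) + I\<close> is well defined, and the
  value at \<open>1\<close> of an extension to \<open>S\<close> is the required element.
\<close>

lemma injective_divisible:
  fixes E :: "('r::comm_ring_1, 'e) module"
  assumes E: "injective_module class_ring E"
    and I: "0 \<in> I" "\<And>p q. \<lbrakk>p \<in> I; q \<in> I\<rbrakk> \<Longrightarrow> p + q \<in> I" "\<And>s p. p \<in> I \<Longrightarrow> s * p \<in> I"
    and v: "\<And>s. v * s \<in> I \<Longrightarrow> s \<in> I"
    and e: "e \<in> carrier E" "\<And>s. s \<in> I \<Longrightarrow> s \<odot>\<^bsub>E\<^esub> e = \<zero>\<^bsub>E\<^esub>"
  shows "\<exists>e'\<in>carrier E. v \<odot>\<^bsub>E\<^esub> e' = e \<and> (\<forall>s\<in>I. s \<odot>\<^bsub>E\<^esub> e' = \<zero>\<^bsub>E\<^esub>)"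
proof -
  have M: "module class_ring E" using E by (simp add: injective_module_def)
  interpret module class_ring E by fact
  note md = module_class_ringD[OF M]
  define A where "A = {v * s + j | s j. j \<in> I}"
  \<comment> \<open>An arbitrary choice of \<open>s\<close> suffices: another choice differs by an element of \<open>I\<close>, which kills \<open>e\<close>.\<close>
  define h where "h x = (SOME s. \<exists>j\<in>I. x = v * s + j) \<odot>\<^bsub>E\<^esub> e" for x
  have h: "h (v * s + j) = s \<odot>\<^bsub>E\<^esub> e" if "j \<in> I" for s j
  proof -
    define t where "t = (SOME t. \<exists>j'\<in>I. v * s + j = v * t + j')"
    have "\<exists>j'\<in>I. v * s + j = v * t + j'"
      unfolding t_def by (rule someI[of _ s]) (use that in auto)
    then obtain j' where j': "j' \<in> I" "v * s + j = v * t + j'" by blast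
    have "v * (s - t) = j' + (-1) * j" using j'(2) by (simp add: algebra_simps)
    hence "s - t \<in> I" using v I(2)[OF j'(1) I(3)[OF that, of "-1"]] by simp
    hence "s \<odot>\<^bsub>E\<^esub> e \<ominus>\<^bsub>E\<^esub> t \<odot>\<^bsub>E\<^esub> e = \<zero>\<^bsub>E\<^esub>" using e md(5) by metis
    hence "s \<odot>\<^bsub>E\<^esub> e = t \<odot>\<^bsub>E\<^esub> e" using e md(1) by (metis M.minus_eq_zero_iff)
    thus ?thesis by (simp add: h_def t_def)
  qed
  have A0: "j \<in> A" if "j \<in> I" for j
    unfolding A_def using that by (intro CollectI exI[of _ 0] exI[of _ j]) simp
  have "submodule A class_ring (self_module :: ('r,'r) module)"
  proof (rule module.submoduleI[OF module_self_module])
    show "\<zero>\<^bsub>self_module\<^esub> \<in> A" using A0 I(1) by simp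
    have mul: "s * x \<in> A" if "x \<in> A" for s x
    proof -
      from that obtain t j where "x = v * t + j" "j \<in> I" by (auto simp: A_def)
      hence "s * x = v * (s * t) + s * j" "s * j \<in> I" using I(3) by (auto simp: algebra_simps)
      thus ?thesis unfolding A_def by blast
    qed
    show "a \<odot>\<^bsub>self_module\<^esub> x \<in> A" if "x \<in> A" for a x using mul[OF that] by simp
    interpret S: module class_ring "self_module :: ('r,'r) module" by (rule module_self_module)
    show "\<ominus>\<^bsub>self_module\<^esub> x \<in> A" if "x \<in> A" for x
      using mul[OF that, of "-1"] S.M.minus_equality[of "-x" x] by simp
    show "x \<oplus>\<^bsub>self_module\<^esub> y \<in> A" if "x \<in> A" "y \<in> A" for x y
    proof -
      from that obtain t j t' j' where "x = v * t + j" "j \<in> I" "y = v * t' + j'" "j' \<in> I"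
        by (auto simp: A_def)
      hence "x + y = v * (t + t') + (j + j')" "j + j' \<in> I" using I(2) by (auto simp: algebra_simps)
      thus ?thesis unfolding A_def by auto
    qed
  qed simp
  moreover have "h \<in> module_maps class_ring (self_module\<lparr>carrier := A\<rparr>) E"
    unfolding module_maps_def
  proof (clarsimp, intro conjI ballI allI)
    show "h \<in> A \<rightarrow> carrier E" using h e md(1) by (auto simp: A_def)
  next
    fix x y assume "x \<in> A" "y \<in> A"
    then obtain t j t' j' where x: "x = v * t + j" "j \<in> I" "y = v * t' + j'" "j' \<in> I"
      by (auto simp: A_def)
    have xy: "x + y = v * (t + t') + (j + j')" "j + j' \<in> I" using I(2) x by (auto simp: algebra_simps)
    have "h (x + y) = (t + t') \<odot>\<^bsub>E\<^esub> e" by (simp only: xy h)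
    thus "h (x + y) = h x \<oplus>\<^bsub>E\<^esub> h y" using x e by (simp only: h md)
  next
    fix s x assume "x \<in> A"
    then obtain t j where x: "x = v * t + j" "j \<in> I" by (auto simp: A_def)
    have "s * x = v * (s * t) + s * j" "s * j \<in> I" using I(3) x by (auto simp: algebra_simps)
    thus "h (s * x) = s \<odot>\<^bsub>E\<^esub> h x" using h x md(6) e by simp
  qed
  ultimately obtain g where g: "g \<in> module_maps class_ring self_module E" "\<forall>x\<in>A. g x = h x"
    using E module_self_module unfolding injective_module_def by blast
  have g1: "g s = s \<odot>\<^bsub>E\<^esub> g 1" for s
    using g(1) unfolding module_maps_def by simp (metis mult.right_neutral)
  have gc: "g 1 \<in> carrier E" using g(1) unfolding module_maps_def by auto
  have "v \<in> A" unfolding A_def using I(1) by (intro CollectI exI[of _ 1] exI[of _ 0]) simp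
  hence "v \<odot>\<^bsub>E\<^esub> g 1 = e" using g(2) h[OF I(1), of 1] g1[of v] e md(7) by simp
  moreover have "s \<odot>\<^bsub>E\<^esub> g 1 = \<zero>\<^bsub>E\<^esub>" if "s \<in> I" for s
    using A0[OF that] g(2) h[OF that, of 0] g1[of s] e md(8) by simp
  ultimately show ?thesis using gc by blast
qed

section \<open>Complexes of injective modules resolving a hypersurface ring\<close>

text \<open>
  An injective resolution of \<open>S/fS\<close> from which the augmentation has been eliminated: only the image
  \<open>\<eta>\<close> of \<open>1\<close> is kept.
\<close>

locale injective_hypersurface_complex =
  fixes E :: "nat \<Rightarrow> ('r::comm_ring_1, 'e) module" and d :: "nat \<Rightarrow> 'e \<Rightarrow> 'e"
    and \<eta> :: 'e and f :: 'r
  assumes injective: "injective_module class_ring (E i)"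
    and d_maps: "d i \<in> module_maps class_ring (E i) (E (Suc i))"
    and eta_closed: "\<eta> \<in> carrier (E 0)"
    and kernel_0: "x \<in> carrier (E 0) \<Longrightarrow> d 0 x = \<zero>\<^bsub>E 1\<^esub> \<longleftrightarrow> (\<exists>s. x = s \<odot>\<^bsub>E 0\<^esub> \<eta>)"
    and ann_eta: "s \<odot>\<^bsub>E 0\<^esub> \<eta> = \<zero>\<^bsub>E 0\<^esub> \<longleftrightarrow> f dvd s"
    and kernel_Suc: "x \<in> carrier (E (Suc i)) \<Longrightarrow>
      d (Suc i) x = \<zero>\<^bsub>E (Suc (Suc i))\<^esub> \<longleftrightarrow> (\<exists>w\<in>carrier (E i). x = d i w)"
begin

lemma module_E: "module class_ring (E i)"
  using injective by (simp add: injective_module_def)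

lemma abelian_group_E: "abelian_group (E i)"
  using module_E by (rule module.axioms)

lemmas smult_laws [simp] = module_class_ringD[OF module_E]

lemma group_laws [simp]:
  "\<lbrakk>x \<in> carrier (E i); y \<in> carrier (E i)\<rbrakk> \<Longrightarrow> x \<oplus>\<^bsub>E i\<^esub> y \<in> carrier (E i)"
  "\<lbrakk>x \<in> carrier (E i); y \<in> carrier (E i)\<rbrakk> \<Longrightarrow> x \<ominus>\<^bsub>E i\<^esub> y \<in> carrier (E i)"
  "\<zero>\<^bsub>E i\<^esub> \<in> carrier (E i)"
  "x \<in> carrier (E i) \<Longrightarrow> x \<oplus>\<^bsub>E i\<^esub> \<zero>\<^bsub>E i\<^esub> = x"
  "x \<in> carrier (E i) \<Longrightarrow> \<zero>\<^bsub>E i\<^esub> \<oplus>\<^bsub>E i\<^esub> x = x"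
  "x \<in> carrier (E i) \<Longrightarrow> x \<ominus>\<^bsub>E i\<^esub> \<zero>\<^bsub>E i\<^esub> = x"
  "x \<in> carrier (E i) \<Longrightarrow> x \<ominus>\<^bsub>E i\<^esub> x = \<zero>\<^bsub>E i\<^esub>"
  "\<lbrakk>x \<in> carrier (E i); y \<in> carrier (E i)\<rbrakk> \<Longrightarrow> x \<oplus>\<^bsub>E i\<^esub> (y \<ominus>\<^bsub>E i\<^esub> x) = y"
proof -
  interpret abelian_group "E i" by (rule abelian_group_E)
  show "x \<in> carrier (E i) \<Longrightarrow> x \<ominus>\<^bsub>E i\<^esub> \<zero>\<^bsub>E i\<^esub> = x"
    using add_minus_cancel[of "\<zero>\<^bsub>E i\<^esub>" x] by simp
  show "\<lbrakk>x \<in> carrier (E i); y \<in> carrier (E i)\<rbrakk> \<Longrightarrow> x \<ominus>\<^bsub>E i\<^esub> y \<in> carrier (E i)"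
    by (rule minus_closed)
  show "\<lbrakk>x \<in> carrier (E i); y \<in> carrier (E i)\<rbrakk> \<Longrightarrow> x \<oplus>\<^bsub>E i\<^esub> (y \<ominus>\<^bsub>E i\<^esub> x) = y"
    by (rule add_minus_cancel)
  show "x \<in> carrier (E i) \<Longrightarrow> x \<ominus>\<^bsub>E i\<^esub> x = \<zero>\<^bsub>E i\<^esub>"
    by (simp add: minus_eq_zero_iff)
  show "\<lbrakk>x \<in> carrier (E i); y \<in> carrier (E i)\<rbrakk> \<Longrightarrow> x \<oplus>\<^bsub>E i\<^esub> y \<in> carrier (E i)"
    by (rule a_closed)
  show "x \<in> carrier (E i) \<Longrightarrow> x \<oplus>\<^bsub>E i\<^esub> \<zero>\<^bsub>E i\<^esub> = x" by (rule r_zero)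
  show "x \<in> carrier (E i) \<Longrightarrow> \<zero>\<^bsub>E i\<^esub> \<oplus>\<^bsub>E i\<^esub> x = x" by (rule l_zero)
  show "\<zero>\<^bsub>E i\<^esub> \<in> carrier (E i)" by (rule zero_closed)
qed

lemma d_laws [simp]:
  "x \<in> carrier (E i) \<Longrightarrow> d i x \<in> carrier (E (Suc i))"
  "\<lbrakk>x \<in> carrier (E i); y \<in> carrier (E i)\<rbrakk> \<Longrightarrow> d i (x \<oplus>\<^bsub>E i\<^esub> y) = d i x \<oplus>\<^bsub>E (Suc i)\<^esub> d i y"
  "x \<in> carrier (E i) \<Longrightarrow> d i (s \<odot>\<^bsub>E i\<^esub> x) = s \<odot>\<^bsub>E (Suc i)\<^esub> d i x"
  using d_maps[of i] by (auto simp: module_maps_def)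

lemma d_zero [simp]: "d i \<zero>\<^bsub>E i\<^esub> = \<zero>\<^bsub>E (Suc i)\<^esub>"
  using d_laws(3)[of "\<zero>\<^bsub>E i\<^esub>" i 0] d_laws(1)[of "\<zero>\<^bsub>E i\<^esub>" i] by simp

lemma minus_eq_add_smult:
  "\<lbrakk>x \<in> carrier (E i); y \<in> carrier (E i)\<rbrakk> \<Longrightarrow> x \<ominus>\<^bsub>E i\<^esub> y = x \<oplus>\<^bsub>E i\<^esub> (-1) \<odot>\<^bsub>E i\<^esub> y"
proof -
  assume xy: "x \<in> carrier (E i)" "y \<in> carrier (E i)"
  interpret abelian_group "E i" by (rule abelian_group_E)
  have "y \<oplus>\<^bsub>E i\<^esub> (-1) \<odot>\<^bsub>E i\<^esub> y = \<zero>\<^bsub>E i\<^esub>"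
    using smult_laws(2)[of y i 1 "-1"] xy by simp
  hence "\<ominus>\<^bsub>E i\<^esub> y = (-1) \<odot>\<^bsub>E i\<^esub> y"
    using xy by (intro minus_equality) (simp_all add: a_comm)
  thus ?thesis by (simp add: a_minus_def)
qed

lemma d_minus [simp]:
  "\<lbrakk>x \<in> carrier (E i); y \<in> carrier (E i)\<rbrakk> \<Longrightarrow> d i (x \<ominus>\<^bsub>E i\<^esub> y) = d i x \<ominus>\<^bsub>E (Suc i)\<^esub> d i y"
  by (simp add: minus_eq_add_smult del: smult_laws(5))

lemma d_d [simp]: "x \<in> carrier (E i) \<Longrightarrow> d (Suc i) (d i x) = \<zero>\<^bsub>E (Suc (Suc i))\<^esub>"
  using kernel_Suc[of "d i x" i] by auto

text \<open>
  The degree \<open>i\<close> part of the subcomplex \<open>A\<^sub>r = Hom(S/(u\<^sub>0, \<dots>, u\<^bsub>r-1\<^esub>), E)\<close>.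
\<close>

definition ann :: "(nat \<Rightarrow> 'r) \<Rightarrow> nat \<Rightarrow> nat \<Rightarrow> 'e set" where
  "ann u r i = {x \<in> carrier (E i). \<forall>j<r. u j \<odot>\<^bsub>E i\<^esub> x = \<zero>\<^bsub>E i\<^esub>}"

lemma ann_carrier: "x \<in> ann u r i \<Longrightarrow> x \<in> carrier (E i)"
  by (simp add: ann_def)

lemma ann_0 [simp]: "ann u 0 i = carrier (E i)"
  by (simp add: ann_def)

lemma ann_Suc: "x \<in> ann u (Suc r) i \<longleftrightarrow> x \<in> ann u r i \<and> u r \<odot>\<^bsub>E i\<^esub> x = \<zero>\<^bsub>E i\<^esub>"
  by (auto simp: ann_def less_Suc_eq)

lemma smult_comm: "x \<in> carrier (E i) \<Longrightarrow> r \<odot>\<^bsub>E i\<^esub> (s \<odot>\<^bsub>E i\<^esub> x) = s \<odot>\<^bsub>E i\<^esub> (r \<odot>\<^bsub>E i\<^esub> x)"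
  by (metis mult.commute smult_laws(6))

lemma ann_smult [simp]: "x \<in> ann u r i \<Longrightarrow> s \<odot>\<^bsub>E i\<^esub> x \<in> ann u r i"
  by (auto simp: ann_def smult_comm[of _ _ _ s])

lemma ann_zero [simp]: "\<zero>\<^bsub>E i\<^esub> \<in> ann u r i"
  by (auto simp: ann_def)

lemma ann_add [simp]: "\<lbrakk>x \<in> ann u r i; y \<in> ann u r i\<rbrakk> \<Longrightarrow> x \<oplus>\<^bsub>E i\<^esub> y \<in> ann u r i"
  by (auto simp: ann_def)

lemma ann_minus [simp]: "\<lbrakk>x \<in> ann u r i; y \<in> ann u r i\<rbrakk> \<Longrightarrow> x \<ominus>\<^bsub>E i\<^esub> y \<in> ann u r i"
  by (simp add: minus_eq_add_smult ann_carrier)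

lemma ann_d [simp]: "x \<in> ann u r i \<Longrightarrow> d i x \<in> ann u r (Suc i)"
  by (auto simp: ann_def simp flip: d_laws(3))

lemma ann_gen_ideal:
  "x \<in> ann u r i \<Longrightarrow> s \<in> gen_ideal u r \<Longrightarrow> s \<odot>\<^bsub>E i\<^esub> x = \<zero>\<^bsub>E i\<^esub>"
proof (induction r arbitrary: s)
  case (Suc r)
  then obtain q c where "q \<in> gen_ideal u r" "s = q + c * u r" by (auto simp: gen_ideal_Suc)
  moreover have "x \<in> ann u r i" "u r \<odot>\<^bsub>E i\<^esub> x = \<zero>\<^bsub>E i\<^esub>" "x \<in> carrier (E i)"
    using Suc.prems(1) by (auto simp: ann_Suc ann_carrier)
  ultimately show ?case using Suc.IH by simp
qed (simp add: ann_carrier)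

lemma ann_mono: "\<lbrakk>x \<in> ann u r i; q \<le> r; \<And>j. u' j = t j * u j\<rbrakk> \<Longrightarrow> x \<in> ann u' q i"
  by (auto simp: ann_def)

lemma ann_Suc_minus:
  "\<lbrakk>x \<in> ann u r i; y \<in> ann u r i; u r \<odot>\<^bsub>E i\<^esub> x = u r \<odot>\<^bsub>E i\<^esub> y\<rbrakk> \<Longrightarrow> x \<ominus>\<^bsub>E i\<^esub> y \<in> ann u (Suc r) i"
  using ann_carrier[of x u r i] ann_carrier[of y u r i] by (simp add: ann_Suc)

lemma ann_divisible:
  assumes "regular_seq u n" "r < n" "x \<in> ann u r i"
  shows "\<exists>y\<in>ann u r i. x = u r \<odot>\<^bsub>E i\<^esub> y"
proof -
  have "\<exists>y\<in>carrier (E i). u r \<odot>\<^bsub>E i\<^esub> y = x \<and> (\<forall>s\<in>gen_ideal u r. s \<odot>\<^bsub>E i\<^esub> y = \<zero>\<^bsub>E i\<^esub>)"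
  proof (rule injective_divisible[OF injective])
    show "u r * s \<in> gen_ideal u r \<Longrightarrow> s \<in> gen_ideal u r" for s
      using assms(1,2) unfolding regular_seq_def by blast
  qed (simp_all only: zero_in_gen_ideal gen_ideal_add gen_ideal_mult ann_carrier[OF assms(3)]
      ann_gen_ideal[OF assms(3)])
  then obtain y where y: "y \<in> carrier (E i)" "u r \<odot>\<^bsub>E i\<^esub> y = x"
    "\<And>s. s \<in> gen_ideal u r \<Longrightarrow> s \<odot>\<^bsub>E i\<^esub> y = \<zero>\<^bsub>E i\<^esub>" by blast
  have "u j \<odot>\<^bsub>E i\<^esub> y = \<zero>\<^bsub>E i\<^esub>" if "j < r" for j
    using y(3) gen_ideal_member[OF that] by blast
  hence "y \<in> ann u r i" using y(1) by (simp add: ann_def)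
  thus ?thesis using y(2) by blast
qed

text \<open>
  Long exact sequence of \<open>0 \<rightarrow> A\<^bsub>r+1\<^esub> \<rightarrow> A\<^sub>r \<rightarrow> A\<^sub>r \<rightarrow> 0\<close>, written out on elements: a primitive \<open>w\<close> of \<open>z\<close> in \<open>A\<^sub>r\<close>
  is corrected by a coboundary so that \<open>u\<^sub>r\<close> kills it.
\<close>

lemma cohomology_vanishes:
  assumes "regular_seq u n" "r \<le> n" "r \<le> i" "z \<in> ann u r (Suc i)" "d (Suc i) z = \<zero>\<^bsub>E (Suc (Suc i))\<^esub>"
  shows "\<exists>w\<in>ann u r i. z = d i w"
  using assms(2-)
proof (induction r arbitrary: i z)
  case 0
  thus ?case using kernel_Suc[of z i] by auto
next
  case (Suc r)
  then obtain i' where i': "i = Suc i'" by (cases i) auto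
  obtain w where w: "w \<in> ann u r i" "z = d i w"
    using Suc.IH[of i z] Suc.prems by (auto simp: ann_Suc)
  note [simp] = ann_carrier[OF w(1)] ann_carrier[OF w(1), unfolded i']
  have "d i (u r \<odot>\<^bsub>E i\<^esub> w) = \<zero>\<^bsub>E (Suc i)\<^esub>"
    using Suc.prems w by (simp add: ann_Suc)
  then obtain \<omega> where o: "\<omega> \<in> ann u r i'" "u r \<odot>\<^bsub>E i\<^esub> w = d i' \<omega>"
    using Suc.IH[of i' "u r \<odot>\<^bsub>E i\<^esub> w"] Suc.prems w i' by auto
  obtain \<omega>' where o': "\<omega>' \<in> ann u r i'" "\<omega> = u r \<odot>\<^bsub>E i'\<^esub> \<omega>'"
    using ann_divisible[OF assms(1) _ o(1)] Suc.prems by auto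
  note [simp] = ann_carrier[OF o'(1)] ann_carrier[OF o(1)]
  have "w \<ominus>\<^bsub>E i\<^esub> d i' \<omega>' \<in> ann u (Suc r) i"
    using w o o' i' by (intro ann_Suc_minus) simp_all
  moreover have "z = d i (w \<ominus>\<^bsub>E i\<^esub> d i' \<omega>')"
    using w o' i' by simp
  ultimately show ?case by blast
qed

text \<open>
  The coboundaries of \<open>A\<^sub>r\<close> in degree \<open>r\<close>, the top degree in which \<open>A\<^sub>r\<close> has cohomology.
\<close>

fun bd :: "(nat \<Rightarrow> 'r) \<Rightarrow> nat \<Rightarrow> 'e set" where
  "bd u 0 = {\<zero>\<^bsub>E 0\<^esub>}"
| "bd u (Suc r) = d r ` ann u (Suc r) r"

lemma bd_ann: "b \<in> bd u r \<Longrightarrow> b \<in> ann u r r"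
  by (cases r) auto

lemma bd_carrier: "b \<in> bd u r \<Longrightarrow> b \<in> carrier (E r)"
  using bd_ann ann_carrier by blast

lemma bd_cocycle: "b \<in> bd u r \<Longrightarrow> d r b = \<zero>\<^bsub>E (Suc r)\<^esub>"
  by (cases r) (auto dest: ann_carrier)

lemma bd_add [simp]: "\<lbrakk>b \<in> bd u r; c \<in> bd u r\<rbrakk> \<Longrightarrow> b \<oplus>\<^bsub>E r\<^esub> c \<in> bd u r"
proof (cases r)
  case (Suc q)
  assume "b \<in> bd u r" "c \<in> bd u r"
  then obtain v w where "v \<in> ann u r q" "b = d q v" "w \<in> ann u r q" "c = d q w" using Suc by auto
  moreover from this have "v \<in> carrier (E q)" "w \<in> carrier (E q)" using ann_carrier by blast+
  ultimately have "b \<oplus>\<^bsub>E r\<^esub> c = d q (v \<oplus>\<^bsub>E q\<^esub> w)" "v \<oplus>\<^bsub>E q\<^esub> w \<in> ann u r q" using Suc by auto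
  thus ?thesis using Suc by auto
qed auto

lemma bd_smult [simp]: "b \<in> bd u r \<Longrightarrow> s \<odot>\<^bsub>E r\<^esub> b \<in> bd u r"
proof (cases r)
  case (Suc q)
  assume "b \<in> bd u r"
  then obtain v where "v \<in> ann u r q" "b = d q v" using Suc by auto
  moreover from this have "v \<in> carrier (E q)" using ann_carrier by blast
  ultimately have "s \<odot>\<^bsub>E r\<^esub> b = d q (s \<odot>\<^bsub>E q\<^esub> v)" "s \<odot>\<^bsub>E q\<^esub> v \<in> ann u r q" using Suc by auto
  thus ?thesis using Suc by auto
qed auto

lemma bd_minus [simp]: "\<lbrakk>b \<in> bd u r; c \<in> bd u r\<rbrakk> \<Longrightarrow> b \<ominus>\<^bsub>E r\<^esub> c \<in> bd u r"
  by (simp add: minus_eq_add_smult bd_carrier)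

lemma bd_divisible:
  assumes "regular_seq u n" "r < n" "b \<in> bd u r"
  shows "\<exists>c\<in>bd u r. b = u r \<odot>\<^bsub>E r\<^esub> c"
proof (cases r)
  case 0
  with assms(3) show ?thesis by simp
next
  case (Suc q)
  with assms(3) obtain w where w: "w \<in> ann u r q" "b = d q w" by auto
  obtain w' where "w' \<in> ann u r q" "w = u r \<odot>\<^bsub>E q\<^esub> w'" using ann_divisible[OF assms(1,2) w(1)] by blast
  moreover from this have "w' \<in> carrier (E q)" using ann_carrier by blast
  ultimately have "b = u r \<odot>\<^bsub>E r\<^esub> d q w'" "d q w' \<in> bd u r" using w Suc by auto
  thus ?thesis by blast
qed

text \<open>
  The cocycles obtained from \<open>\<eta>\<close> by iterating the connecting homomorphisms
  \<open>H\<^sup>r(A\<^sub>r) \<rightarrow> H\<^sup>r\<^sup>+\<^sup>1(A\<^bsub>r+1\<^esub>)\<close>: divide by \<open>u\<^sub>r\<close> and apply the differential. This is a relation because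
  the quotient by \<open>u\<^sub>r\<close> is not unique.
\<close>

inductive top_gen :: "(nat \<Rightarrow> 'r) \<Rightarrow> nat \<Rightarrow> 'e \<Rightarrow> bool" for u where
  top_gen_0: "top_gen u 0 \<eta>"
| top_gen_Suc: "\<lbrakk>top_gen u r (u r \<odot>\<^bsub>E r\<^esub> w); w \<in> ann u r r\<rbrakk> \<Longrightarrow> top_gen u (Suc r) (d r w)"

lemma top_gen_ann: "top_gen u r \<zeta> \<Longrightarrow> \<zeta> \<in> ann u r r \<and> d r \<zeta> = \<zero>\<^bsub>E (Suc r)\<^esub>"
proof (induction rule: top_gen.induct)
  case top_gen_0
  have "\<exists>s. \<eta> = s \<odot>\<^bsub>E 0\<^esub> \<eta>" using eta_closed by (intro exI[of _ 1]) simp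
  thus ?case using eta_closed kernel_0[of \<eta>] by simp
next
  case (top_gen_Suc r w)
  thus ?case using ann_carrier[of w u r r] by (simp add: ann_Suc)
qed

lemma top_gen_exists:
  assumes "regular_seq u n" "r \<le> n"
  shows "\<exists>\<zeta>. top_gen u r \<zeta>"
  using assms(2)
proof (induction r)
  case (Suc r)
  then obtain \<zeta> where z: "top_gen u r \<zeta>" by auto
  then obtain w where "w \<in> ann u r r" "\<zeta> = u r \<odot>\<^bsub>E r\<^esub> w"
    using ann_divisible[OF assms(1), of r \<zeta> r] top_gen_ann Suc.prems by auto
  thus ?case using z top_gen_Suc by blast
qed (auto intro: top_gen_0)

text \<open>
  Since \<open>H\<^sup>r\<^sup>+\<^sup>1(A\<^sub>r)\<close> vanishes, the connecting homomorphism onto \<open>H\<^sup>r\<^sup>+\<^sup>1(A\<^bsub>r+1\<^esub>)\<close> is surjective, so generators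
  go to generators.
\<close>

lemma top_gen_generates:
  assumes "regular_seq u n" "r \<le> n" "top_gen u r \<zeta>" "z \<in> ann u r r" "d r z = \<zero>\<^bsub>E (Suc r)\<^esub>"
  shows "\<exists>s. \<exists>b\<in>bd u r. z = s \<odot>\<^bsub>E r\<^esub> \<zeta> \<oplus>\<^bsub>E r\<^esub> b"
  using assms(3,2,4,5)
proof (induction arbitrary: z rule: top_gen.induct)
  case top_gen_0
  thus ?case using kernel_0[of z] eta_closed by auto
next
  case (top_gen_Suc r w)
  obtain x where x: "x \<in> ann u r r" "z = d r x"
    using cohomology_vanishes[OF assms(1), of r r z] top_gen_Suc by (auto simp: ann_Suc)
  note [simp] = ann_carrier[OF x(1)] ann_carrier[OF top_gen_Suc.hyps(2)]
  have "d r (u r \<odot>\<^bsub>E r\<^esub> x) = \<zero>\<^bsub>E (Suc r)\<^esub>" using x top_gen_Suc.prems by (simp add: ann_Suc)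
  then obtain s b where s: "b \<in> bd u r" "u r \<odot>\<^bsub>E r\<^esub> x = s \<odot>\<^bsub>E r\<^esub> (u r \<odot>\<^bsub>E r\<^esub> w) \<oplus>\<^bsub>E r\<^esub> b"
    using top_gen_Suc.IH[of "u r \<odot>\<^bsub>E r\<^esub> x"] top_gen_Suc.prems x by auto
  obtain c where c: "c \<in> bd u r" "b = u r \<odot>\<^bsub>E r\<^esub> c"
    using bd_divisible[OF assms(1) _ s(1)] top_gen_Suc.prems by auto
  note [simp] = bd_carrier[OF c(1)] bd_cocycle[OF c(1)]
  let ?y = "s \<odot>\<^bsub>E r\<^esub> w \<oplus>\<^bsub>E r\<^esub> c"
  have "x \<ominus>\<^bsub>E r\<^esub> ?y \<in> ann u (Suc r) r"
    using x s c top_gen_Suc.hyps by (intro ann_Suc_minus) (simp_all add: bd_ann smult_comm[of _ _ s])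
  hence "d r (x \<ominus>\<^bsub>E r\<^esub> ?y) \<in> bd u (Suc r)" unfolding bd.simps by (rule imageI)
  moreover have "z = s \<odot>\<^bsub>E (Suc r)\<^esub> d r w \<oplus>\<^bsub>E (Suc r)\<^esub> d r (x \<ominus>\<^bsub>E r\<^esub> ?y)"
    using x c top_gen_Suc.hyps by simp
  ultimately show ?case by blast
qed

text \<open>
  The kernel of the same connecting homomorphism is \<open>u\<^sub>r H\<^sup>r(A\<^sub>r)\<close>. Hence the annihilator of the generator
  grows by \<open>u\<^sub>r\<close> in each step, starting with the annihilator \<open>fS\<close> of \<open>\<eta>\<close>.
\<close>

lemma top_gen_bd_iff:
  assumes "regular_seq u n" "r \<le> n" "top_gen u r \<zeta>"
  shows "s \<odot>\<^bsub>E r\<^esub> \<zeta> \<in> bd u r \<longleftrightarrow> (\<exists>c. s - c * f \<in> gen_ideal u r)"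
  using assms(3,2)
proof (induction arbitrary: s rule: top_gen.induct)
  case top_gen_0
  show ?case by (auto simp: ann_eta dvd_def mult.commute)
next
  case (top_gen_Suc r w)
  have w: "w \<in> ann u r r" "r < n" "r \<le> n" using top_gen_Suc by auto
  note [simp] = ann_carrier[OF w(1)]
  have IH: "s \<odot>\<^bsub>E r\<^esub> (u r \<odot>\<^bsub>E r\<^esub> w) \<in> bd u r \<longleftrightarrow> (\<exists>c. s - c * f \<in> gen_ideal u r)" for s
    using top_gen_Suc.IH w by blast
  show ?case
  proof
    assume "s \<odot>\<^bsub>E (Suc r)\<^esub> d r w \<in> bd u (Suc r)"
    then obtain \<beta> where b: "\<beta> \<in> ann u (Suc r) r" "s \<odot>\<^bsub>E (Suc r)\<^esub> d r w = d r \<beta>" by auto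
    note [simp] = ann_carrier[OF b(1)]
    let ?x = "s \<odot>\<^bsub>E r\<^esub> w \<ominus>\<^bsub>E r\<^esub> \<beta>"
    have "?x \<in> ann u r r" "d r ?x = \<zero>\<^bsub>E (Suc r)\<^esub>" using b w by (simp_all add: ann_Suc)
    then obtain c b' where c: "b' \<in> bd u r" "?x = c \<odot>\<^bsub>E r\<^esub> (u r \<odot>\<^bsub>E r\<^esub> w) \<oplus>\<^bsub>E r\<^esub> b'"
      using top_gen_generates[OF assms(1) w(3) top_gen_Suc.hyps(1)] by blast
    note [simp] = bd_carrier[OF c(1)]
    have "s \<odot>\<^bsub>E r\<^esub> (u r \<odot>\<^bsub>E r\<^esub> w) = u r \<odot>\<^bsub>E r\<^esub> ?x"
      using b w by (simp add: ann_Suc smult_comm[of _ _ s])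
    also have "\<dots> = (u r * c) \<odot>\<^bsub>E r\<^esub> (u r \<odot>\<^bsub>E r\<^esub> w) \<oplus>\<^bsub>E r\<^esub> u r \<odot>\<^bsub>E r\<^esub> b'"
      using c w by simp
    finally have "(s - u r * c) \<odot>\<^bsub>E r\<^esub> (u r \<odot>\<^bsub>E r\<^esub> w) = u r \<odot>\<^bsub>E r\<^esub> b'"
      using c w abelian_group.add_minus_shift[OF abelian_group_E] by simp
    hence "(s - u r * c) \<odot>\<^bsub>E r\<^esub> (u r \<odot>\<^bsub>E r\<^esub> w) \<in> bd u r" using c by simp
    then obtain k where "s - u r * c - k * f \<in> gen_ideal u r" using IH by blast
    moreover have "s - k * f = (s - u r * c - k * f) + c * u r" by (simp add: algebra_simps)
    ultimately have "s - k * f \<in> gen_ideal u (Suc r)" unfolding gen_ideal_Suc by blast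
    thus "\<exists>c. s - c * f \<in> gen_ideal u (Suc r)" ..
  next
    assume "\<exists>c. s - c * f \<in> gen_ideal u (Suc r)"
    then obtain c q k where c: "q \<in> gen_ideal u r" "s - c * f = q + k * u r"
      by (auto simp: gen_ideal_Suc)
    have "(s - k * u r) - c * f \<in> gen_ideal u r" using c by (simp add: algebra_simps)
    hence "(s - k * u r) \<odot>\<^bsub>E r\<^esub> (u r \<odot>\<^bsub>E r\<^esub> w) \<in> bd u r" using IH by blast
    then obtain b where b: "b \<in> bd u r" "(s - k * u r) \<odot>\<^bsub>E r\<^esub> (u r \<odot>\<^bsub>E r\<^esub> w) = u r \<odot>\<^bsub>E r\<^esub> b"
      using bd_divisible[OF assms(1) w(2)] by blast
    note [simp] = bd_carrier[OF b(1)] bd_cocycle[OF b(1)]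
    have "(s - k * u r) \<odot>\<^bsub>E r\<^esub> w \<ominus>\<^bsub>E r\<^esub> b \<in> ann u (Suc r) r"
      using b w by (intro ann_Suc_minus) 
        (simp_all add: bd_ann smult_comm[of _ _ _ "u r"] del: smult_laws(5))
    hence 1: "d r ((s - k * u r) \<odot>\<^bsub>E r\<^esub> w \<ominus>\<^bsub>E r\<^esub> b) \<in> bd u (Suc r)"
      unfolding bd.simps by (rule imageI)
    have 2: "d r ((s - k * u r) \<odot>\<^bsub>E r\<^esub> w \<ominus>\<^bsub>E r\<^esub> b) = (s - k * u r) \<odot>\<^bsub>E (Suc r)\<^esub> d r w"
      using b w by (simp del: smult_laws(5))
    have 3: "s \<odot>\<^bsub>E (Suc r)\<^esub> d r w
        = (s - k * u r) \<odot>\<^bsub>E (Suc r)\<^esub> d r w \<oplus>\<^bsub>E (Suc r)\<^esub> (k * u r) \<odot>\<^bsub>E (Suc r)\<^esub> d r w"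
    proof -
      have "s \<odot>\<^bsub>E (Suc r)\<^esub> d r w = ((s - k * u r) + k * u r) \<odot>\<^bsub>E (Suc r)\<^esub> d r w"
        by (simp only: diff_add_cancel)
      also have "\<dots> = (s - k * u r) \<odot>\<^bsub>E (Suc r)\<^esub> d r w \<oplus>\<^bsub>E (Suc r)\<^esub> (k * u r) \<odot>\<^bsub>E (Suc r)\<^esub> d r w"
        by (rule smult_laws(2)) simp
      finally show ?thesis .
    qed
    have 4: "(k * u r) \<odot>\<^bsub>E (Suc r)\<^esub> d r w = \<zero>\<^bsub>E (Suc r)\<^esub>"
      using top_gen_ann[OF top_gen.top_gen_Suc[OF top_gen_Suc.hyps(1,2)]] w by (simp add: ann_Suc)
    have 5: "(s - k * u r) \<odot>\<^bsub>E (Suc r)\<^esub> d r w \<oplus>\<^bsub>E (Suc r)\<^esub> \<zero>\<^bsub>E (Suc r)\<^esub>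
        = (s - k * u r) \<odot>\<^bsub>E (Suc r)\<^esub> d r w"
      by (rule group_laws(4)) simp
    show "s \<odot>\<^bsub>E (Suc r)\<^esub> d r w \<in> bd u (Suc r)"
      unfolding 3 4 5 using 1 unfolding 2 .
  qed
qed

text \<open>
  The comparison of \<open>Hom(S/(u), E)\<close> with the larger complex \<open>Hom(S/(u'), E)\<close> for \<open>u'\<^sub>j = t\<^sub>j u\<^sub>j\<close>: an element \<open>w\<close>
  with \<open>u\<^sub>r w = \<zeta>\<close> satisfies \<open>u'\<^sub>r w = t\<^sub>r \<zeta>\<close>, so every step contributes one factor \<open>t\<^sub>r\<close>.
\<close>

lemma top_gen_transition:
  assumes "regular_seq u' n" "\<And>j. u' j = t j * u j" "r \<le> n" "top_gen u r \<zeta>" "top_gen u' r \<zeta>'"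
  shows "\<exists>b\<in>bd u' r. \<zeta> = (\<Prod>j<r. t j) \<odot>\<^bsub>E r\<^esub> \<zeta>' \<oplus>\<^bsub>E r\<^esub> b"
  using assms(4,5,3)
proof (induction arbitrary: \<zeta>' rule: top_gen.induct)
  case top_gen_0
  hence "\<zeta>' = \<eta>" by (auto elim: top_gen.cases)
  thus ?case using eta_closed by simp
next
  case (top_gen_Suc r w)
  obtain w' where w': "\<zeta>' = d r w'" "top_gen u' r (u' r \<odot>\<^bsub>E r\<^esub> w')" "w' \<in> ann u' r r"
    using top_gen_Suc.prems(1) by (auto elim: top_gen.cases)
  let ?p = "\<Prod>j<r. t j"
  have w: "w \<in> ann u r r" "w \<in> ann u' r r" "r < n"
    using top_gen_Suc by (auto intro: ann_mono[of w u r r r u' t, OF _ _ assms(2)])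
  note [simp] = ann_carrier[OF w(1)] ann_carrier[OF w'(3)]
  obtain b where b: "b \<in> bd u' r" "u r \<odot>\<^bsub>E r\<^esub> w = ?p \<odot>\<^bsub>E r\<^esub> (u' r \<odot>\<^bsub>E r\<^esub> w') \<oplus>\<^bsub>E r\<^esub> b"
    using top_gen_Suc.IH[OF w'(2)] w by auto
  obtain c where c: "c \<in> bd u' r" "t r \<odot>\<^bsub>E r\<^esub> b = u' r \<odot>\<^bsub>E r\<^esub> c"
    using bd_divisible[OF assms(1) w(3), of "t r \<odot>\<^bsub>E r\<^esub> b"] b by auto
  note [simp] = bd_carrier[OF b(1)] bd_carrier[OF c(1)] bd_cocycle[OF c(1)]
  let ?y = "(t r * ?p) \<odot>\<^bsub>E r\<^esub> w' \<oplus>\<^bsub>E r\<^esub> c"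
  have "u' r \<odot>\<^bsub>E r\<^esub> w = t r \<odot>\<^bsub>E r\<^esub> (u r \<odot>\<^bsub>E r\<^esub> w)" using w by (simp add: assms(2))
  also have "\<dots> = u' r \<odot>\<^bsub>E r\<^esub> ?y"
    using b c w w' by (simp add: smult_comm[of _ _ _ "u' r"] del: smult_laws(6)) 
     (simp add: smult_comm[of _ _ _ "u' r"])
  finally have "w \<ominus>\<^bsub>E r\<^esub> ?y \<in> ann u' (Suc r) r"
    using w w' c by (intro ann_Suc_minus) (simp_all add: bd_ann)
  hence "d r (w \<ominus>\<^bsub>E r\<^esub> ?y) \<in> bd u' (Suc r)" unfolding bd.simps by (rule imageI)
  moreover have "d r w = (\<Prod>j<Suc r. t j) \<odot>\<^bsub>E (Suc r)\<^esub> \<zeta>' \<oplus>\<^bsub>E (Suc r)\<^esub> d r (w \<ominus>\<^bsub>E r\<^esub> ?y)"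
    using w w' c by (simp add: mult.commute)
  ultimately show ?case by blast
qed

text \<open>
  The homological half of the argument. \<open>T\<close> stands for the torsion submodules. The hypothesis on \<open>g\<close> makes \<open>g\<close> times
  the generator for the exponents \<open>k + 1\<close> cohomologous to a torsion cocycle \<open>z\<close>. If \<open>v\<^sub>0\<^sup>k z\<close> is the
  coboundary of a torsion element, then that element is killed by \<open>v\<^sub>j\<^bsup>l+k+1\<^esup>\<close> for some \<open>l\<close>, and passing to these exponents turns
  the equation into a membership in an ideal.
\<close>

lemma uniform_power_imp_membership:
  assumes reg: "\<And>e. regular_seq (\<lambda>j. v j ^ e j) (Suc (Suc q))"
    and ann_T: "\<And>e x. x \<in> ann (\<lambda>j. v j ^ e j) (Suc (Suc q)) (Suc q) \<Longrightarrow> x \<in> T (Suc q)"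
    and T_ann: "\<And>x. x \<in> T q \<Longrightarrow> \<exists>l. x \<in> ann (\<lambda>j. v j ^ l) (Suc q) q"
    and bound: "\<And>z. \<lbrakk>z \<in> T (Suc q); d (Suc q) z = \<zero>\<^bsub>E (Suc (Suc q))\<^esub>\<rbrakk> \<Longrightarrow>
      v 0 ^ k \<odot>\<^bsub>E (Suc q)\<^esub> z \<in> d q ` T q"
    and g: "v (Suc q) ^ M * g - c * f \<in> gen_ideal (\<lambda>j. v j ^ Suc k) (Suc q)"
  shows "\<exists>l c. v 0 ^ k * g * (\<Prod>j<Suc q. v j ^ l) - c * f \<in> gen_ideal (\<lambda>j. v j ^ (l + Suc k)) (Suc q)"
proof -
  let ?N = "Suc q"
  define u where "u j = v j ^ Suc k" for j
  \<comment> \<open>The same sequence, extended by the power of the last element that carries \<open>g\<close> into the ideal.\<close>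
  define e where "e j = (if j < ?N then Suc k else M)" for j
  have regu: "regular_seq u (Suc ?N)" unfolding u_def by (rule reg)
  have ann_u: "x \<in> ann (\<lambda>j. v j ^ e j) ?N i \<longleftrightarrow> x \<in> ann u ?N i" for x i
    by (auto simp: ann_def u_def e_def)
  obtain \<zeta> where \<zeta>: "top_gen u ?N \<zeta>" using top_gen_exists[OF regu, of ?N] by auto
  have \<zeta>_ann: "\<zeta> \<in> ann u ?N ?N" "d ?N \<zeta> = \<zero>\<^bsub>E (Suc ?N)\<^esub>" using top_gen_ann[OF \<zeta>] by auto
  have "(v ?N ^ M * g) \<odot>\<^bsub>E ?N\<^esub> \<zeta> \<in> bd u ?N"
    using g top_gen_bd_iff[OF regu le_SucI[OF le_refl] \<zeta>] unfolding u_def by blast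
  then obtain \<omega> where \<omega>: "\<omega> \<in> ann u ?N q" "(v ?N ^ M * g) \<odot>\<^bsub>E ?N\<^esub> \<zeta> = d q \<omega>" by auto
  obtain \<omega>' where \<omega>': "\<omega>' \<in> ann u ?N q" "\<omega> = v ?N ^ M \<odot>\<^bsub>E q\<^esub> \<omega>'"
    using ann_divisible[OF reg[of e], of ?N \<omega> q] \<omega>(1) ann_u by (auto simp: e_def)
  note [simp] = ann_carrier[OF \<zeta>_ann(1)] ann_carrier[OF \<omega>'(1)]
  \<comment> \<open>Subtracting \<open>d \<omega>'\<close> does not change the class of \<open>g \<zeta>\<close>, and it makes the power \<open>M\<close> of \<open>v N\<close> kill the cocycle.\<close>
  define z where "z = g \<odot>\<^bsub>E ?N\<^esub> \<zeta> \<ominus>\<^bsub>E ?N\<^esub> d q \<omega>'"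
  have "z \<in> ann u ?N ?N" unfolding z_def using \<zeta>_ann \<omega>' by simp
  moreover have "v ?N ^ M \<odot>\<^bsub>E ?N\<^esub> z = \<zero>\<^bsub>E ?N\<^esub>"
    unfolding z_def using \<omega> \<omega>' by simp
  ultimately have "z \<in> ann (\<lambda>j. v j ^ e j) (Suc ?N) ?N"
    by (simp add: ann_Suc[of _ _ ?N] ann_u) (simp add: e_def)
  hence "z \<in> T ?N" by (rule ann_T)
  moreover have "d ?N z = \<zero>\<^bsub>E (Suc ?N)\<^esub>" unfolding z_def using \<zeta>_ann by simp
  ultimately obtain \<beta> where \<beta>: "\<beta> \<in> T q" "v 0 ^ k \<odot>\<^bsub>E ?N\<^esub> z = d q \<beta>" using bound by blast
  obtain l where l: "\<beta> \<in> ann (\<lambda>j. v j ^ l) ?N q" using T_ann[OF \<beta>(1)] by blast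
  define u' where "u' j = v j ^ (l + Suc k)" for j
  have u': "u' j = v j ^ l * u j" "u' j = v j ^ Suc k * v j ^ l" for j
    by (simp_all add: u_def u'_def power_add mult_ac)
  have regu': "regular_seq u' (Suc ?N)" unfolding u'_def by (rule reg)
  have \<beta>': "\<beta> \<in> ann u' ?N q" by (rule ann_mono[OF l _ u'(2)]) simp
  have \<omega>'': "\<omega>' \<in> ann u' ?N q" by (rule ann_mono[OF \<omega>'(1) _ u'(1)]) simp
  obtain \<zeta>' where \<zeta>': "top_gen u' ?N \<zeta>'" using top_gen_exists[OF regu', of ?N] by auto
  define p where "p = (\<Prod>j<?N. v j ^ l)"
  obtain b where b: "b \<in> bd u' ?N" "\<zeta> = p \<odot>\<^bsub>E ?N\<^esub> \<zeta>' \<oplus>\<^bsub>E ?N\<^esub> b"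
    using top_gen_transition[OF regu' u'(1) _ \<zeta> \<zeta>'] unfolding p_def by auto
  define a where "a = v 0 ^ k * g"
  note [simp] = ann_carrier[OF \<beta>'] bd_carrier[OF b(1)] ann_carrier[OF conjunct1[OF top_gen_ann[OF \<zeta>']]]
  have "d q \<beta> \<oplus>\<^bsub>E ?N\<^esub> v 0 ^ k \<odot>\<^bsub>E ?N\<^esub> d q \<omega>' = a \<odot>\<^bsub>E ?N\<^esub> \<zeta>"
  proof -
    interpret N: abelian_group "E ?N" by (rule abelian_group_E)
    have "a \<odot>\<^bsub>E ?N\<^esub> \<zeta> = v 0 ^ k \<odot>\<^bsub>E ?N\<^esub> (d q \<omega>' \<oplus>\<^bsub>E ?N\<^esub> z)"
      by (simp add: z_def a_def del: smult_laws(3,4))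
    also have "\<dots> = v 0 ^ k \<odot>\<^bsub>E ?N\<^esub> d q \<omega>' \<oplus>\<^bsub>E ?N\<^esub> d q \<beta>"
      using \<beta>(2) by (subst smult_laws(3)) (simp_all add: z_def)
    finally show ?thesis by (simp add: N.a_comm)
  qed
  moreover have "d q \<beta> \<oplus>\<^bsub>E ?N\<^esub> v 0 ^ k \<odot>\<^bsub>E ?N\<^esub> d q \<omega>' \<in> bd u' ?N"
    using \<beta>' \<omega>'' by (intro bd_add bd_smult) (auto simp only: bd.simps)
  ultimately have a\<zeta>: "a \<odot>\<^bsub>E ?N\<^esub> \<zeta> \<in> bd u' ?N" by simp
  have "a \<odot>\<^bsub>E ?N\<^esub> \<zeta> = a \<odot>\<^bsub>E ?N\<^esub> b \<oplus>\<^bsub>E ?N\<^esub> (a * p) \<odot>\<^bsub>E ?N\<^esub> \<zeta>'"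
    unfolding b(2) by (simp add: abelian_monoid.a_comm[OF abelian_group.axioms(1)[OF abelian_group_E]])
  hence "a \<odot>\<^bsub>E ?N\<^esub> \<zeta> \<ominus>\<^bsub>E ?N\<^esub> a \<odot>\<^bsub>E ?N\<^esub> b = (a * p) \<odot>\<^bsub>E ?N\<^esub> \<zeta>'"
    by (intro abelian_group.add_minus_shift[OF abelian_group_E]) (simp_all del: smult_laws(6))
  moreover have "a \<odot>\<^bsub>E ?N\<^esub> \<zeta> \<ominus>\<^bsub>E ?N\<^esub> a \<odot>\<^bsub>E ?N\<^esub> b \<in> bd u' ?N"
    by (rule bd_minus[OF a\<zeta> bd_smult[OF b(1)]])
  ultimately have "(a * p) \<odot>\<^bsub>E ?N\<^esub> \<zeta>' \<in> bd u' ?N" by simp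
  hence "\<exists>c. a * p - c * f \<in> gen_ideal u' ?N"
    using top_gen_bd_iff[OF regu' le_SucI[OF le_refl] \<zeta>'] by blast
  thus ?thesis unfolding a_def p_def u'_def by blast
qed

end

section \<open>Torsion and finitely generated cohomology\<close>

text \<open>
  The cosets killed by \<open>v\<^sup>k\<close> form a submodule, and for large \<open>k\<close> it contains the finitely many generators.
\<close>

lemma finitely_generated_quot_bound:
  fixes M :: "('r::comm_ring_1, 'e) module"
  assumes M: "module class_ring M" and B: "submodule B class_ring M"
    and fg: "finitely_generated class_ring (quot_module M B)"
    and tors: "\<And>z. z \<in> carrier M \<Longrightarrow> \<exists>k. v ^ k \<odot>\<^bsub>M\<^esub> z \<in> B"
  shows "\<exists>k. \<forall>z\<in>carrier M. v ^ k \<odot>\<^bsub>M\<^esub> z \<in> B"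
proof -
  interpret module class_ring M by fact
  note md = module_class_ringD[OF M]
  note sub = module.submoduleE[OF M B]
  interpret B: abelian_subgroup B M
    by (rule abelian_subgroupI3)
      (simp_all add: additive_subgroup_def submodule.axioms(1)[OF B] M.abelian_group_axioms)
  have rs: "r \<odot>\<^bsub>M\<^esub> b \<in> B" if "b \<in> B" for r b using sub(4)[of r b] that by simp
  let ?H = "quot_module M B"
  have inv_H: "inv\<^bsub>add_monoid ?H\<^esub> X = inv\<^bsub>M A_Mod B\<^esub> X" for X
    by (simp add: m_inv_def quot_module_def A_FactGroup_def')
  have coset_eq: "x \<in> B +>\<^bsub>M\<^esub> z \<longleftrightarrow> (\<exists>b\<in>B. x = b \<oplus>\<^bsub>M\<^esub> z)" for x z
    by (auto simp: a_r_coset_def')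
  have smult_coset: "r \<odot>\<^bsub>?H\<^esub> (B +>\<^bsub>M\<^esub> z) = B +>\<^bsub>M\<^esub> (r \<odot>\<^bsub>M\<^esub> z)" if z: "z \<in> carrier M" for r z
  proof -
    have "B +>\<^bsub>M\<^esub> (r \<odot>\<^bsub>M\<^esub> x) = B +>\<^bsub>M\<^esub> (r \<odot>\<^bsub>M\<^esub> z)" if "x \<in> B +>\<^bsub>M\<^esub> z" for x
    proof -
      from that obtain b where b: "b \<in> B" "x = b \<oplus>\<^bsub>M\<^esub> z" by (auto simp: coset_eq)
      have "b \<in> carrier M" using b(1) B.a_subset by blast
      hence "r \<odot>\<^bsub>M\<^esub> x = r \<odot>\<^bsub>M\<^esub> b \<oplus>\<^bsub>M\<^esub> r \<odot>\<^bsub>M\<^esub> z" unfolding b(2) using z by (rule md(3))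
      hence "r \<odot>\<^bsub>M\<^esub> x \<in> B +>\<^bsub>M\<^esub> (r \<odot>\<^bsub>M\<^esub> z)" using rs[OF b(1)] unfolding coset_eq by blast
      thus ?thesis using B.a_repr_independence'[OF _ md(1)[OF z]] by blast
    qed
    hence "(\<Union>x\<in>B +>\<^bsub>M\<^esub> z. B +>\<^bsub>M\<^esub> (r \<odot>\<^bsub>M\<^esub> x)) = (\<Union>x\<in>B +>\<^bsub>M\<^esub> z. B +>\<^bsub>M\<^esub> (r \<odot>\<^bsub>M\<^esub> z))"
      by (intro SUP_cong refl)
    also have "\<dots> = B +>\<^bsub>M\<^esub> (r \<odot>\<^bsub>M\<^esub> z)" using B.a_rcos_self[OF z] by blast
    finally show ?thesis by (simp add: quot_module_def)
  qed
  have carrier_H: "carrier ?H = (\<lambda>z. B +>\<^bsub>M\<^esub> z) ` carrier M"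
    unfolding quot_module_def by (simp add: A_RCOSETS_def' a_r_coset_def' image_def) blast
  from fg obtain A where A: "finite A" "A \<subseteq> carrier ?H"
    "\<And>N. submodule N class_ring ?H \<Longrightarrow> A \<subseteq> N \<Longrightarrow> N = carrier ?H"
    unfolding finitely_generated_def by (elim exE conjE) simp
  have "\<forall>X\<in>A. \<exists>k. \<exists>z\<in>carrier M. X = B +>\<^bsub>M\<^esub> z \<and> v ^ k \<odot>\<^bsub>M\<^esub> z \<in> B"
  proof
    fix X assume "X \<in> A"
    hence "X \<in> (\<lambda>z. B +>\<^bsub>M\<^esub> z) ` carrier M" using A(2) unfolding carrier_H by (rule subsetD[rotated])
    then obtain z where "z \<in> carrier M" "X = B +>\<^bsub>M\<^esub> z" by (elim imageE)
    thus "\<exists>k. \<exists>z\<in>carrier M. X = B +>\<^bsub>M\<^esub> z \<and> v ^ k \<odot>\<^bsub>M\<^esub> z \<in> B" using tors by blast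
  qed
  from bchoice[OF this] obtain ex where ex: "\<And>X. X \<in> A \<Longrightarrow>
      \<exists>z\<in>carrier M. X = B +>\<^bsub>M\<^esub> z \<and> v ^ ex X \<odot>\<^bsub>M\<^esub> z \<in> B" by blast
  define k where "k = (\<Sum>X\<in>A. ex X)"
  define N where "N = {B +>\<^bsub>M\<^esub> z | z. z \<in> carrier M \<and> v ^ k \<odot>\<^bsub>M\<^esub> z \<in> B}"
  have NI: "B +>\<^bsub>M\<^esub> z \<in> N" if "z \<in> carrier M" "v ^ k \<odot>\<^bsub>M\<^esub> z \<in> B" for z
    unfolding N_def using that by blast
  have N_carrier: "N \<subseteq> carrier ?H"
    unfolding N_def carrier_H by blast
  have "submodule N class_ring ?H"
  proof (intro submodule.intro subgroup.intro submodule_axioms.intro)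
    show "N \<subseteq> carrier (add_monoid ?H)" using N_carrier by simp
    show "x \<otimes>\<^bsub>add_monoid ?H\<^esub> y \<in> N" if "x \<in> N" "y \<in> N" for x y
    proof -
      from that obtain z z' where z: "z \<in> carrier M" "v ^ k \<odot>\<^bsub>M\<^esub> z \<in> B" "x = B +>\<^bsub>M\<^esub> z"
        "z' \<in> carrier M" "v ^ k \<odot>\<^bsub>M\<^esub> z' \<in> B" "y = B +>\<^bsub>M\<^esub> z'" by (auto simp: N_def)
      hence "x \<otimes>\<^bsub>add_monoid ?H\<^esub> y = B +>\<^bsub>M\<^esub> (z \<oplus>\<^bsub>M\<^esub> z')"
        by (simp add: quot_module_def B.a_rcos_sum)
      thus ?thesis using z NI[of "z \<oplus>\<^bsub>M\<^esub> z'"] sub(5) by (simp add: md)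
    qed
    have "B +>\<^bsub>M\<^esub> \<zero>\<^bsub>M\<^esub> \<in> N" by (rule NI) (simp_all add: md)
    thus "\<one>\<^bsub>add_monoid ?H\<^esub> \<in> N" by (simp add: quot_module_def M.a_coset_add_zero B.a_subset)
    show "inv\<^bsub>add_monoid ?H\<^esub> x \<in> N" if "x \<in> N" for x
    proof -
      from that obtain z where z: "z \<in> carrier M" "v ^ k \<odot>\<^bsub>M\<^esub> z \<in> B" "x = B +>\<^bsub>M\<^esub> z"
        by (auto simp: N_def)
      have "carrier ?H = carrier (M A_Mod B)" by (simp add: quot_module_def A_FactGroup_def')
      hence "x \<in> carrier (M A_Mod B)" using that N_carrier by blast
      hence "inv\<^bsub>add_monoid ?H\<^esub> x = B +>\<^bsub>M\<^esub> (\<ominus>\<^bsub>M\<^esub> z)"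
        unfolding inv_H using B.a_inv_FactGroup[of x] B.a_rcos_inv[OF z(1)] z(3) by simp
      moreover have "v ^ k \<odot>\<^bsub>M\<^esub> (\<ominus>\<^bsub>M\<^esub> z) \<in> B"
        using sub(3)[OF z(2)] smult_r_minus[of "v ^ k" z] z(1) by simp
      ultimately show ?thesis using NI z(1) by simp
    qed
    show "r \<odot>\<^bsub>?H\<^esub> x \<in> N" if "r \<in> carrier class_ring" "x \<in> N" for r x
    proof -
      from that obtain z where z: "z \<in> carrier M" "v ^ k \<odot>\<^bsub>M\<^esub> z \<in> B" "x = B +>\<^bsub>M\<^esub> z"
        by (auto simp: N_def)
      have "v ^ k \<odot>\<^bsub>M\<^esub> (r \<odot>\<^bsub>M\<^esub> z) = r \<odot>\<^bsub>M\<^esub> (v ^ k \<odot>\<^bsub>M\<^esub> z)"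
        using z(1) by (metis md(6) mult.commute)
      thus ?thesis using NI[of "r \<odot>\<^bsub>M\<^esub> z"] rs[OF z(2)] z(1) by (simp add: z(3) smult_coset md)
    qed
  qed
  moreover have "A \<subseteq> N"
  proof
    fix X assume X: "X \<in> A"
    have "ex X \<le> k" unfolding k_def using X A(1) by (simp add: member_le_sum)
    then obtain j where "k = j + ex X" by (metis le_add_diff_inverse2)
    obtain z where z: "z \<in> carrier M" "X = B +>\<^bsub>M\<^esub> z" "v ^ ex X \<odot>\<^bsub>M\<^esub> z \<in> B"
      using ex[OF X] by blast
    have "v ^ k \<odot>\<^bsub>M\<^esub> z = v ^ j \<odot>\<^bsub>M\<^esub> (v ^ ex X \<odot>\<^bsub>M\<^esub> z)"
      unfolding \<open>k = j + ex X\<close> power_add by (rule md(6)[OF z(1)])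
    hence "v ^ k \<odot>\<^bsub>M\<^esub> z \<in> B" using rs[OF z(3)] by simp
    thus "X \<in> N" unfolding z(2) by (rule NI[OF z(1)])
  qed
  ultimately have N: "N = carrier ?H" by (rule A(3))
  have "v ^ k \<odot>\<^bsub>M\<^esub> z \<in> B" if z: "z \<in> carrier M" for z
  proof -
    have "B +>\<^bsub>M\<^esub> z \<in> N" unfolding N carrier_H using z by (rule imageI)
    then obtain z' where z': "z' \<in> carrier M" "v ^ k \<odot>\<^bsub>M\<^esub> z' \<in> B" "B +>\<^bsub>M\<^esub> z = B +>\<^bsub>M\<^esub> z'"
      by (auto simp: N_def)
    have "z \<in> B +>\<^bsub>M\<^esub> z'" using B.a_rcos_self[OF z] z'(3) by simp
    then obtain b where "b \<in> B" "z = b \<oplus>\<^bsub>M\<^esub> z'" by (auto simp: coset_eq)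
    thus ?thesis using z' rs sub(5) B.a_subset by (simp add: md subsetD)
  qed
  thus ?thesis by blast
qed

lemma ideal_power_simps:
  "Q [^]\<^bsub>ideals_set R\<^esub> (0::nat) = carrier R"
  "Q [^]\<^bsub>ideals_set R\<^esub> (Suc k) = ideal_prod R (Q [^]\<^bsub>ideals_set R\<^esub> k) Q"
  by (simp_all add: nat_pow_def ideals_set_def)

context
  fixes Q :: "'r::comm_ring_1 set"
  assumes Q: "ideal Q class_ring"
begin

interpretation R: cring "class_ring :: 'r ring" by (rule cring_class_ring)

lemma ideal_power_ideal: "ideal (Q [^]\<^bsub>ideals_set class_ring\<^esub> (k::nat)) class_ring"
proof (induction k)
  case 0
  show ?case unfolding ideal_power_simps by (rule R.oneideal)
next
  case (Suc k)
  show ?case unfolding ideal_power_simps by (rule R.ideal_prod_is_ideal[OF Suc Q])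
qed

lemma ideal_power_decreasing:
  "(k::nat) \<le> l \<Longrightarrow> Q [^]\<^bsub>ideals_set class_ring\<^esub> l \<subseteq> Q [^]\<^bsub>ideals_set class_ring\<^esub> k"
proof (induction rule: dec_induct)
  case (step n)
  have "Q [^]\<^bsub>ideals_set class_ring\<^esub> Suc n \<subseteq> Q [^]\<^bsub>ideals_set class_ring\<^esub> n"
    unfolding ideal_power_simps using R.ideal_prod_inter[OF ideal_power_ideal Q] by blast
  with step show ?case by blast
qed simp

lemma power_in_ideal_power: "v \<in> Q \<Longrightarrow> v ^ k \<in> Q [^]\<^bsub>ideals_set class_ring\<^esub> k"
proof (induction k)
  case 0
  show ?case unfolding ideal_power_simps by simp
next
  case (Suc k)
  thus ?case unfolding ideal_power_simps
    using ideal_prod.prod[of "v ^ k" _ v Q class_ring] by (simp add: mult.commute)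
qed

lemma torsion_submodule:
  assumes M: "module class_ring M"
  shows "submodule (torsion class_ring Q M) class_ring M"
proof -
  interpret module class_ring M by fact
  note md = module_class_ringD[OF M]
  show ?thesis
  proof (rule submoduleI)
    show "torsion class_ring Q M \<subseteq> carrier M" by (auto simp: torsion_def)
    show "\<zero>\<^bsub>M\<^esub> \<in> torsion class_ring Q M" by (auto simp: torsion_def md)
    show "\<ominus>\<^bsub>M\<^esub> x \<in> torsion class_ring Q M" if "x \<in> torsion class_ring Q M" for x
    proof -
      from that obtain k where x: "x \<in> carrier M"
        "\<And>s. s \<in> Q [^]\<^bsub>ideals_set class_ring\<^esub> (k::nat) \<Longrightarrow> s \<odot>\<^bsub>M\<^esub> x = \<zero>\<^bsub>M\<^esub>"
        by (auto simp: torsion_def)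
      have "s \<odot>\<^bsub>M\<^esub> (\<ominus>\<^bsub>M\<^esub> x) = \<zero>\<^bsub>M\<^esub>" if "s \<in> Q [^]\<^bsub>ideals_set class_ring\<^esub> k" for s
        using x smult_r_minus[of s x] that by simp
      thus ?thesis unfolding torsion_def using x(1) by auto
    qed
    show "x \<oplus>\<^bsub>M\<^esub> y \<in> torsion class_ring Q M"
      if "x \<in> torsion class_ring Q M" "y \<in> torsion class_ring Q M" for x y
    proof -
      from that obtain k l where x: "x \<in> carrier M" "y \<in> carrier M"
        "\<And>s. s \<in> Q [^]\<^bsub>ideals_set class_ring\<^esub> (k::nat) \<Longrightarrow> s \<odot>\<^bsub>M\<^esub> x = \<zero>\<^bsub>M\<^esub>"
        "\<And>s. s \<in> Q [^]\<^bsub>ideals_set class_ring\<^esub> (l::nat) \<Longrightarrow> s \<odot>\<^bsub>M\<^esub> y = \<zero>\<^bsub>M\<^esub>"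
        by (auto simp: torsion_def)
      have "s \<odot>\<^bsub>M\<^esub> (x \<oplus>\<^bsub>M\<^esub> y) = \<zero>\<^bsub>M\<^esub>" if "s \<in> Q [^]\<^bsub>ideals_set class_ring\<^esub> (max k l)" for s
        using x that ideal_power_decreasing[of k "max k l"] ideal_power_decreasing[of l "max k l"]
        by (simp add: md subset_iff)
      thus ?thesis unfolding torsion_def using x(1,2) by blast
    qed
    show "r \<odot>\<^bsub>M\<^esub> x \<in> torsion class_ring Q M" if "x \<in> torsion class_ring Q M" for r x
    proof -
      from that obtain k where x: "x \<in> carrier M"
        "\<And>s. s \<in> Q [^]\<^bsub>ideals_set class_ring\<^esub> (k::nat) \<Longrightarrow> s \<odot>\<^bsub>M\<^esub> x = \<zero>\<^bsub>M\<^esub>"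
        by (auto simp: torsion_def)
      have "s \<odot>\<^bsub>M\<^esub> (r \<odot>\<^bsub>M\<^esub> x) = \<zero>\<^bsub>M\<^esub>" if "s \<in> Q [^]\<^bsub>ideals_set class_ring\<^esub> k" for s
        using x that by (metis md(6) md(9) mult.commute)
      thus ?thesis unfolding torsion_def using x(1) by (auto simp: md)
    qed
  qed
qed

lemma module_map_torsion:
  assumes M: "module class_ring M" "module class_ring N" and h: "h \<in> module_maps class_ring M N"
    and x: "x \<in> torsion class_ring Q M"
  shows "h x \<in> torsion class_ring Q N"
proof -
  note md = module_class_ringD[OF M(1)] module_class_ringD[OF M(2)]
  have "h \<zero>\<^bsub>M\<^esub> = h (0 \<odot>\<^bsub>M\<^esub> x)" using x by (simp add: md torsion_def)
  also have "\<dots> = 0 \<odot>\<^bsub>N\<^esub> h x" using h x by (auto simp: module_maps_def torsion_def)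
  also have "\<dots> = \<zero>\<^bsub>N\<^esub>" using h x by (intro md) (auto simp: module_maps_def torsion_def)
  finally have h0: "h \<zero>\<^bsub>M\<^esub> = \<zero>\<^bsub>N\<^esub>" .
  from x obtain k where x: "x \<in> carrier M"
        "\<And>s. s \<in> Q [^]\<^bsub>ideals_set class_ring\<^esub> (k::nat) \<Longrightarrow> s \<odot>\<^bsub>M\<^esub> x = \<zero>\<^bsub>M\<^esub>"
    by (auto simp: torsion_def)
  have "s \<odot>\<^bsub>N\<^esub> h x = h (s \<odot>\<^bsub>M\<^esub> x)" for s using h x(1) by (auto simp: module_maps_def)
  hence "s \<odot>\<^bsub>N\<^esub> h x = \<zero>\<^bsub>N\<^esub>" if "s \<in> Q [^]\<^bsub>ideals_set class_ring\<^esub> k" for s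
    using x(2)[OF that] h0 by simp
  moreover have "h x \<in> carrier N" using h x(1) by (auto simp: module_maps_def)
  ultimately show ?thesis unfolding torsion_def by blast
qed

end

lemma (in injective_hypersurface_complex) local_cohomology_bound:
  assumes Q: "ideal Q class_ring" and v: "v \<in> Q"
    and fg: "finitely_generated class_ring (local_cohomology class_ring Q E d (Suc q))"
  shows "\<exists>k. \<forall>z\<in>torsion class_ring Q (E (Suc q)). d (Suc q) z = \<zero>\<^bsub>E (Suc (Suc q))\<^esub> \<longrightarrow>
    v ^ k \<odot>\<^bsub>E (Suc q)\<^esub> z \<in> d q ` torsion class_ring Q (E q)"
proof -
  let ?T = "\<lambda>i. torsion class_ring Q (E i)"
  let ?Z = "{z \<in> ?T (Suc q). d (Suc q) z = \<zero>\<^bsub>E (Suc (Suc q))\<^esub>}"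
  let ?B = "d q ` ?T q"
  let ?M = "E (Suc q)\<lparr>carrier := ?Z\<rparr>"
  have T_carrier: "x \<in> carrier (E i)" if "x \<in> ?T i" for x i using that by (simp add: torsion_def)
  note T = module.submoduleE[OF module_E torsion_submodule[OF Q module_E]]
  interpret E: module class_ring "E (Suc q)" by (rule module_E)
  have T_zero: "\<zero>\<^bsub>E i\<^esub> \<in> ?T i" for i
    using T(2)[of i] T(4)[of 0 _ i] T_carrier by fastforce
  have Z: "submodule ?Z class_ring (E (Suc q))"
  proof (rule E.submoduleI)
    show "\<ominus>\<^bsub>E (Suc q)\<^esub> a \<in> ?Z" if "a \<in> ?Z" for a
    proof -
      have "\<ominus>\<^bsub>E (Suc q)\<^esub> a = (-1) \<odot>\<^bsub>E (Suc q)\<^esub> a"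
        using minus_eq_add_smult[of "\<zero>\<^bsub>E (Suc q)\<^esub>" "Suc q" a] that T_carrier
        by (auto simp: a_minus_def)
      thus ?thesis using that T T_carrier by simp
    qed
  qed (use T T_zero T_carrier in auto)
  have M: "module class_ring ?M" by (rule submodule.submodule_is_module[OF Z module_E])
  have "submodule ?B class_ring (E (Suc q))"
  proof (rule E.submoduleI)
    show "\<ominus>\<^bsub>E (Suc q)\<^esub> a \<in> ?B" if "a \<in> ?B" for a
    proof -
      from that obtain x where x: "x \<in> ?T q" "a = d q x" by auto
      have "\<ominus>\<^bsub>E (Suc q)\<^esub> a = (-1) \<odot>\<^bsub>E (Suc q)\<^esub> a"
        using minus_eq_add_smult[of "\<zero>\<^bsub>E (Suc q)\<^esub>" "Suc q" a] x T_carrier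
        by (auto simp: a_minus_def)
      also have "\<dots> = d q ((-1) \<odot>\<^bsub>E q\<^esub> x)" using x T_carrier by simp
      finally show ?thesis using T(4)[of "-1" x q] x by simp
    qed
    show "a \<oplus>\<^bsub>E (Suc q)\<^esub> b \<in> ?B" if "a \<in> ?B" "b \<in> ?B" for a b
    proof -
      from that obtain x y where "x \<in> ?T q" "a = d q x" "y \<in> ?T q" "b = d q y" by auto
      thus ?thesis using T(5)[of x q y] T_carrier d_laws(2)[of x q y] by (metis imageI)
    qed
    show "r \<odot>\<^bsub>E (Suc q)\<^esub> a \<in> ?B" if "a \<in> ?B" for r a
    proof -
      from that obtain x where "x \<in> ?T q" "a = d q x" by auto
      thus ?thesis using T(4)[of r x q] T_carrier d_laws(3)[of x q r] by (metis UNIV_I class_ring_simps(1) imageI)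
    qed
    show "\<zero>\<^bsub>E (Suc q)\<^esub> \<in> ?B" using T_zero[of q] d_zero[of q] by (metis imageI)
  qed (use T_carrier in auto)
  moreover have "?B \<subseteq> ?Z"
    using module_map_torsion[OF Q module_E module_E d_maps] T_carrier by auto
  ultimately have B: "submodule ?B class_ring ?M"
    using module.submoduleE[OF module_E] 
    by (intro module.module_incl_imp_submodule[OF M]) (auto dest: submodule.submodule_is_module[OF _ module_E])
  have "local_cohomology class_ring Q E d (Suc q) = quot_module ?M ?B"
    by (simp add: local_cohomology_def cohomology_def torsion_module_def a_kernel_def')
  with fg have "finitely_generated class_ring (quot_module ?M ?B)" by simp
  moreover have "\<exists>k. v ^ k \<odot>\<^bsub>?M\<^esub> z \<in> ?B" if "z \<in> carrier ?M" for z
  proof -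
    from that obtain k where "\<forall>s\<in>Q [^]\<^bsub>ideals_set class_ring\<^esub> (k::nat). s \<odot>\<^bsub>E (Suc q)\<^esub> z = \<zero>\<^bsub>E (Suc q)\<^esub>"
      by (auto simp: torsion_def)
    hence "v ^ k \<odot>\<^bsub>?M\<^esub> z = d q \<zero>\<^bsub>E q\<^esub>" using power_in_ideal_power[OF Q v, of k] by simp
    thus ?thesis using T_zero by blast
  qed
  ultimately have "\<exists>k. \<forall>z\<in>carrier ?M. v ^ k \<odot>\<^bsub>?M\<^esub> z \<in> ?B"
    by (rule finitely_generated_quot_bound[OF M B])
  then obtain k where "\<forall>z\<in>?Z. v ^ k \<odot>\<^bsub>E (Suc q)\<^esub> z \<in> ?B" by auto
  thus ?thesis by (intro exI[of _ k]) blast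
qed

section \<open>Polynomials: terms, products and substitutions\<close>

definition select_terms :: "('a \<Rightarrow> bool) \<Rightarrow> ('a \<Rightarrow>\<^sub>0 'b::zero) \<Rightarrow> ('a \<Rightarrow>\<^sub>0 'b)" where
  "select_terms A p = Poly_Mapping.mapp (\<lambda>t c. if A t then c else 0) p"

lemma lookup_select_terms: "Poly_Mapping.lookup (select_terms A p) t = (if A t then Poly_Mapping.lookup p t else 0)"
  by (auto simp: select_terms_def lookup_mapp when_def in_keys_iff)

lemma keys_select_terms: "Poly_Mapping.keys (select_terms A p) = {t \<in> Poly_Mapping.keys p. A t}"
  by (auto simp: in_keys_iff lookup_select_terms split: if_splits)

lemma select_terms_complement: "select_terms A p + select_terms (\<lambda>t. \<not> A t) p = (p :: 'a \<Rightarrow>\<^sub>0 'b::comm_monoid_add)"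
  by (rule poly_mapping_eqI) (simp add: lookup_add lookup_select_terms)

lemma sum_single: "(\<Sum>t\<in>Poly_Mapping.keys p. Poly_Mapping.single t (Poly_Mapping.lookup p t)) = p"
  by (rule poly_mapping_eqI) (auto simp: lookup_sum lookup_single when_def in_keys_iff)

lemma poly_mult_as_sum:
  fixes p q :: "'a::comm_monoid_add \<Rightarrow>\<^sub>0 'b::comm_semiring_0"
  shows "p * q = (\<Sum>s\<in>Poly_Mapping.keys p. \<Sum>t\<in>Poly_Mapping.keys q.
    Poly_Mapping.single (s + t) (Poly_Mapping.lookup p s * Poly_Mapping.lookup q t))"
proof -
  have "p * q = (\<Sum>s\<in>Poly_Mapping.keys p. Poly_Mapping.single s (Poly_Mapping.lookup p s))
      * (\<Sum>t\<in>Poly_Mapping.keys q. Poly_Mapping.single t (Poly_Mapping.lookup q t))"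
    by (simp only: sum_single)
  thus ?thesis by (simp only: sum_product mult_single)
qed

lemma lookup_mult_keys:
  fixes p q :: "'a::comm_monoid_add \<Rightarrow>\<^sub>0 'b::comm_semiring_0"
  shows "Poly_Mapping.lookup (p * q) k = (\<Sum>s\<in>Poly_Mapping.keys p. \<Sum>t\<in>Poly_Mapping.keys q.
    if s + t = k then Poly_Mapping.lookup p s * Poly_Mapping.lookup q t else 0)"
  by (subst poly_mult_as_sum) (simp add: lookup_sum lookup_single when_def)

lemma in_keys_multE:
  assumes "k \<in> Poly_Mapping.keys (p * q)"
  obtains s t where "k = s + t" "s \<in> Poly_Mapping.keys p" "t \<in> Poly_Mapping.keys q"
  using keys_mult[of p q] assms by blast

lemma in_keys_sumE:
  assumes "k \<in> Poly_Mapping.keys (\<Sum>i\<in>I. p i)"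
  obtains i where "i \<in> I" "k \<in> Poly_Mapping.keys (p i)"
proof -
  have "\<exists>i\<in>I. Poly_Mapping.lookup (p i) k \<noteq> 0"
  proof (rule ccontr)
    assume "\<not> ?thesis"
    hence "Poly_Mapping.lookup (\<Sum>i\<in>I. p i) k = 0" by (simp add: lookup_sum)
    thus False using assms by (simp add: in_keys_iff)
  qed
  thus ?thesis using that by (auto simp: in_keys_iff)
qed

lemma lookup_monomial_mult:
  fixes p :: "('v \<Rightarrow>\<^sub>0 nat) \<Rightarrow>\<^sub>0 'b::comm_semiring_1"
  shows "Poly_Mapping.lookup (Poly_Mapping.single s 1 * p) (s + t) = Poly_Mapping.lookup p t"
proof -
  have "Poly_Mapping.lookup (Poly_Mapping.single s 1 * p) (s + t)
      = (\<Sum>t'\<in>Poly_Mapping.keys p. if t' = t then Poly_Mapping.lookup p t' else 0)"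
    by (simp add: lookup_mult_keys cong: if_cong)
  also have "\<dots> = Poly_Mapping.lookup p t"
    by (simp add: in_keys_iff)
  finally show ?thesis .
qed

lemma keys_monomial_mult:
  fixes p :: "('v \<Rightarrow>\<^sub>0 nat) \<Rightarrow>\<^sub>0 'b::comm_semiring_1"
  shows "Poly_Mapping.keys (Poly_Mapping.single s 1 * p) = (+) s ` Poly_Mapping.keys p"
proof
  show "Poly_Mapping.keys (Poly_Mapping.single s 1 * p) \<subseteq> (+) s ` Poly_Mapping.keys p"
  proof
    fix k assume "k \<in> Poly_Mapping.keys (Poly_Mapping.single s 1 * p)"
    then obtain s' t where "k = s' + t" "s' \<in> Poly_Mapping.keys (Poly_Mapping.single s (1::'b))"
      "t \<in> Poly_Mapping.keys p" by (rule in_keys_multE)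
    thus "k \<in> (+) s ` Poly_Mapping.keys p" by simp
  qed
  show "(+) s ` Poly_Mapping.keys p \<subseteq> Poly_Mapping.keys (Poly_Mapping.single s 1 * p)"
    by (auto simp: in_keys_iff lookup_monomial_mult)
qed

lemma monomial_dvd:
  fixes p :: "('v \<Rightarrow>\<^sub>0 nat) \<Rightarrow>\<^sub>0 'b::comm_semiring_1"
  assumes "\<And>t. t \<in> Poly_Mapping.keys p \<Longrightarrow> \<exists>t'. t = s + t'"
  shows "\<exists>q. p = Poly_Mapping.single s 1 * q"
proof -
  define q where "q = (\<Sum>t\<in>Poly_Mapping.keys p. Poly_Mapping.single (t - s) (Poly_Mapping.lookup p t))"
  have "s + (t - s) = t" if "t \<in> Poly_Mapping.keys p" for t using assms[OF that] by auto
  hence "Poly_Mapping.single s 1 * q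
      = (\<Sum>t\<in>Poly_Mapping.keys p. Poly_Mapping.single t (Poly_Mapping.lookup p t))"
    by (simp add: q_def sum_distrib_left mult_single)
  thus ?thesis using sum_single[of p] by metis
qed

text \<open>
  Finitely many exponent vectors are separated by one linear form with natural coefficients: each new
  coefficient exceeds all values of the form built so far, as in a positional number system.
\<close>

lemma separating_weights:
  fixes T :: "('v \<Rightarrow> nat) set"
  assumes "finite T" "finite V"
  shows "\<exists>w. \<forall>s\<in>T. \<forall>t\<in>T. (\<Sum>i\<in>V. w i * s i) = (\<Sum>i\<in>V. w i * t i) \<longrightarrow> (\<forall>i\<in>V. s i = t i)"
  using assms(2)
proof induction
  case (insert j V)
  then obtain w where w: "\<And>s t. \<lbrakk>s \<in> T; t \<in> T; (\<Sum>i\<in>V. w i * s i) = (\<Sum>i\<in>V. w i * t i)\<rbrakk>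
      \<Longrightarrow> \<forall>i\<in>V. s i = t i" by blast
  define W where "W s = (\<Sum>i\<in>V. w i * s i)" for s :: "'v \<Rightarrow> nat"
  \<comment> \<open>Any strict upper bound for the values of \<open>W\<close> on \<open>T\<close> serves as the next base.\<close>
  define B where "B = Suc (\<Sum>s\<in>T. W s)"
  have B: "W s < B" if "s \<in> T" for s
    using member_le_sum[OF that, of W] assms(1) by (simp add: B_def)
  define w' where "w' = w(j := B)"
  have w': "(\<Sum>i\<in>insert j V. w' i * s i) = W s + s j * B" for s
  proof -
    have "(\<Sum>i\<in>V. w' i * s i) = W s"
      unfolding W_def w'_def using insert.hyps by (intro sum.cong) auto
    thus ?thesis using insert.hyps by (simp add: w'_def)
  qed
  have "\<forall>i\<in>insert j V. s i = t i"
    if "s \<in> T" "t \<in> T" "(\<Sum>i\<in>insert j V. w' i * s i) = (\<Sum>i\<in>insert j V. w' i * t i)" for s t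
  proof -
    have eq: "W s + s j * B = W t + t j * B" using that(3) unfolding w' .
    have "W s = (W s + s j * B) mod B" using B[OF that(1)] by simp
    also have "\<dots> = W t" unfolding eq using B[OF that(2)] by simp
    finally have Weq: "W s = W t" .
    moreover have "B > 0" by (simp add: B_def)
    ultimately have "s j = t j" using eq by simp
    thus ?thesis using w[OF that(1,2)] Weq by (simp add: W_def)
  qed
  thus ?case by blast
qed simp

text \<open>
  The index type carries no order, so there is no leading monomial. A separating weight replaces the
  monomial order: the terms of maximal weight multiply to a term that nothing cancels.
\<close>

lemma poly_mult_nonzero:
  fixes p q :: "('v::finite \<Rightarrow>\<^sub>0 nat) \<Rightarrow>\<^sub>0 'k::idom"
  assumes "p \<noteq> 0" "q \<noteq> 0"
  shows "p * q \<noteq> 0"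
proof -
  let ?K = "Poly_Mapping.keys"
  obtain w :: "'v \<Rightarrow> nat" where w: "\<And>s t. \<lbrakk>s \<in> ?K p; t \<in> ?K p;
      (\<Sum>i\<in>UNIV. w i * Poly_Mapping.lookup s i) = (\<Sum>i\<in>UNIV. w i * Poly_Mapping.lookup t i)\<rbrakk>
      \<Longrightarrow> \<forall>i. Poly_Mapping.lookup s i = Poly_Mapping.lookup t i"
    using separating_weights[of "Poly_Mapping.lookup ` ?K p" "UNIV :: 'v set"] by auto
  define W where "W t = (\<Sum>i\<in>UNIV. w i * Poly_Mapping.lookup t i)" for t
  have W_add: "W (s + t) = W s + W t" for s t
    by (simp add: W_def lookup_add algebra_simps sum.distrib)
  have W_inj: "s = t" if "s \<in> ?K p" "t \<in> ?K p" "W s = W t" for s t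
    using w[OF that(1,2)] that(3) by (auto simp: W_def intro: poly_mapping_eqI)
  have max: "\<exists>s\<in>?K r. \<forall>t\<in>?K r. W t \<le> W s" if "r \<noteq> 0" for r :: "('v \<Rightarrow>\<^sub>0 nat) \<Rightarrow>\<^sub>0 'k"
  proof -
    have "?K r \<noteq> {}" using that by simp
    hence "Max (W ` ?K r) \<in> W ` ?K r" by (intro Max_in) auto
    then obtain s where "s \<in> ?K r" "Max (W ` ?K r) = W s" by auto
    thus ?thesis by (metis Max_ge finite_imageI finite_keys imageI)
  qed
  obtain s0 where s0: "s0 \<in> ?K p" "\<And>s. s \<in> ?K p \<Longrightarrow> W s \<le> W s0" using max[OF assms(1)] by blast
  obtain t0 where t0: "t0 \<in> ?K q" "\<And>t. t \<in> ?K q \<Longrightarrow> W t \<le> W t0" using max[OF assms(2)] by blast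
  have uniq: "s + t = s0 + t0 \<longleftrightarrow> s = s0 \<and> t = t0" if "s \<in> ?K p" "t \<in> ?K q" for s t
  proof
    assume eq: "s + t = s0 + t0"
    hence "W s + W t = W s0 + W t0" by (metis W_add)
    with s0(2)[OF that(1)] t0(2)[OF that(2)] have "W s = W s0" by linarith
    hence "s = s0" using W_inj that s0 by blast
    thus "s = s0 \<and> t = t0" using eq by simp
  qed simp
  have "Poly_Mapping.lookup (p * q) (s0 + t0) = (\<Sum>s\<in>?K p. \<Sum>t\<in>?K q.
      if s = s0 then (if t = t0 then Poly_Mapping.lookup p s0 * Poly_Mapping.lookup q t0 else 0) else 0)"
    unfolding lookup_mult_keys by (intro sum.cong refl) (auto simp: uniq)
  also have "\<dots> = Poly_Mapping.lookup p s0 * Poly_Mapping.lookup q t0"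
  proof -
    have "(\<Sum>t\<in>?K q. if s = s0 then (if t = t0 then c else 0) else 0) = (if s = s0 then c else 0)"
      for s and c :: 'k using t0(1) by simp
    thus ?thesis using s0(1) by simp
  qed
  finally show ?thesis using s0(1) t0(1) by (auto simp: in_keys_iff)
qed

lemma poly_power_nonzero:
  fixes p :: "('v::finite \<Rightarrow>\<^sub>0 nat) \<Rightarrow>\<^sub>0 'k::idom"
  shows "p \<noteq> 0 \<Longrightarrow> p ^ n \<noteq> 0"
  by (induction n) (simp_all add: poly_mult_nonzero)

definition var :: "'v \<Rightarrow> ('v \<Rightarrow>\<^sub>0 nat) \<Rightarrow>\<^sub>0 'k::comm_ring_1" where
  "var i = Poly_Mapping.single (Poly_Mapping.single i 1) 1"

lemma var_power: "var i ^ n = Poly_Mapping.single (Poly_Mapping.single i n) 1"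
  by (induction n) (simp_all add: var_def mult_single flip: single_add)

lemma prod_monomials:
  "(\<Prod>i\<in>I. Poly_Mapping.single (t i) (1::'k::comm_semiring_1)) = Poly_Mapping.single (\<Sum>i\<in>I. t i) 1"
  by (induction I rule: infinite_finite_induct) (simp_all add: mult_single)

definition mon_subst :: "('v::finite \<Rightarrow> 'r::comm_ring_1) \<Rightarrow> ('v \<Rightarrow>\<^sub>0 nat) \<Rightarrow> 'r" where
  "mon_subst \<phi> t = (\<Prod>i\<in>UNIV. \<phi> i ^ Poly_Mapping.lookup t i)"

lemma mon_subst_zero [simp]: "mon_subst \<phi> 0 = 1"
  by (simp add: mon_subst_def)

lemma mon_subst_add: "mon_subst \<phi> (s + t) = mon_subst \<phi> s * mon_subst \<phi> t"
  by (simp add: mon_subst_def lookup_add power_add prod.distrib)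

lemma mon_subst_single: "mon_subst \<phi> (Poly_Mapping.single i n) = \<phi> i ^ n"
proof -
  have "mon_subst \<phi> (Poly_Mapping.single i n) = (\<Prod>j\<in>UNIV. if j = i then \<phi> i ^ n else 1)"
    unfolding mon_subst_def by (intro prod.cong) (auto simp: lookup_single when_def)
  thus ?thesis by simp
qed

lemma mon_subst_var: "mon_subst var t = Poly_Mapping.single t 1"
proof -
  have "(\<Sum>i\<in>UNIV. Poly_Mapping.single i (Poly_Mapping.lookup t i)) = t"
    by (rule poly_mapping_eqI) (simp add: lookup_sum lookup_single when_def)
  thus ?thesis by (simp add: mon_subst_def var_power prod_monomials)
qed

text \<open>
  Evaluation of a polynomial at polynomials \<open>\<phi> i\<close>; it is the homomorphism of \<open>K\<close>-algebras
  with \<open>var i \<mapsto> \<phi> i\<close>.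
\<close>

definition subst :: "('v::finite \<Rightarrow> ('w \<Rightarrow>\<^sub>0 nat) \<Rightarrow>\<^sub>0 'k) \<Rightarrow> (('v \<Rightarrow>\<^sub>0 nat) \<Rightarrow>\<^sub>0 'k) \<Rightarrow>
    ('w \<Rightarrow>\<^sub>0 nat) \<Rightarrow>\<^sub>0 'k::comm_ring_1" where
  "subst \<phi> p = (\<Sum>t\<in>Poly_Mapping.keys p. Poly_Mapping.single 0 (Poly_Mapping.lookup p t) * mon_subst \<phi> t)"

lemma subst_superset:
  assumes "finite K" "Poly_Mapping.keys p \<subseteq> K"
  shows "subst \<phi> p = (\<Sum>t\<in>K. Poly_Mapping.single 0 (Poly_Mapping.lookup p t) * mon_subst \<phi> t)"
  unfolding subst_def using assms
  by (intro sum.mono_neutral_left) (auto simp: in_keys_iff)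

lemma subst_add: "subst \<phi> (p + q) = subst \<phi> p + subst \<phi> q"
proof -
  let ?K = "Poly_Mapping.keys p \<union> Poly_Mapping.keys q"
  have "Poly_Mapping.keys (p + q) \<subseteq> ?K" by (rule keys_add)
  thus ?thesis
    by (simp add: subst_superset[of ?K] lookup_add single_add algebra_simps sum.distrib)
qed

lemma subst_zero [simp]: "subst \<phi> 0 = 0"
  by (simp add: subst_def)

lemma subst_sum: "subst \<phi> (\<Sum>i\<in>I. p i) = (\<Sum>i\<in>I. subst \<phi> (p i))"
  by (induction I rule: infinite_finite_induct) (simp_all add: subst_add)

lemma subst_single: "subst \<phi> (Poly_Mapping.single t c) = Poly_Mapping.single 0 c * mon_subst \<phi> t"
  by (subst subst_superset[of "{t}"]) auto

lemma subst_one [simp]: "subst \<phi> 1 = 1"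
  using subst_single[of \<phi> 0 1] by simp

lemma subst_mult: "subst \<phi> (p * q) = subst \<phi> p * subst \<phi> q"
proof -
  let ?p = "\<lambda>t. Poly_Mapping.lookup p t" and ?q = "\<lambda>t. Poly_Mapping.lookup q t"
  have "subst \<phi> (p * q) = (\<Sum>s\<in>Poly_Mapping.keys p. \<Sum>t\<in>Poly_Mapping.keys q.
      Poly_Mapping.single (0 + 0) (?p s * ?q t) * (mon_subst \<phi> s * mon_subst \<phi> t))"
    by (subst poly_mult_as_sum) (simp add: subst_sum subst_single mon_subst_add)
  also have "\<dots> = subst \<phi> p * subst \<phi> q"
    unfolding subst_def sum_product mult_single[symmetric] by (simp only: mult_ac)
  finally show ?thesis .
qed

lemma subst_power: "subst \<phi> (p ^ n) = subst \<phi> p ^ n"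
  by (induction n) (simp_all add: subst_mult)

lemma subst_prod: "subst \<phi> (\<Prod>i\<in>I. p i) = (\<Prod>i\<in>I. subst \<phi> (p i))"
  by (induction I rule: infinite_finite_induct) (simp_all add: subst_mult)

lemma subst_uminus: "subst \<phi> (- p) = - subst \<phi> p"
  using subst_add[of \<phi> p "- p"] by (simp add: eq_neg_iff_add_eq_0 add.commute)

lemma subst_diff: "subst \<phi> (p - q) = subst \<phi> p - subst \<phi> q"
  using subst_add[of \<phi> p "- q"] by (simp add: subst_uminus)

lemma subst_var [simp]: "subst \<phi> (var i) = \<phi> i"
  by (simp add: var_def subst_single mon_subst_single)

lemma subst_const [simp]: "subst \<phi> (Poly_Mapping.single 0 c) = Poly_Mapping.single 0 c"
  by (simp add: subst_single)

lemma subst_subst: "subst \<phi> (subst \<psi> p) = subst (\<lambda>i. subst \<phi> (\<psi> i)) p"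
proof -
  have "subst \<phi> (mon_subst \<psi> t) = mon_subst (\<lambda>i. subst \<phi> (\<psi> i)) t" for t
    by (simp add: mon_subst_def subst_prod subst_power)
  thus ?thesis
    by (subst (2) subst_def) (simp add: subst_sum subst_mult, simp add: subst_def)
qed

lemma subst_id [simp]: "subst var p = p"
  unfolding subst_def mon_subst_var by (simp add: mult_single sum_single)

section \<open>Degrees\<close>

lemma exponent_split:
  fixes t :: "'v \<Rightarrow>\<^sub>0 nat"
  assumes "n \<le> Poly_Mapping.lookup t i"
  shows "t = Poly_Mapping.single i n + (t - Poly_Mapping.single i n)"
  using assms by (intro poly_mapping_eqI) (auto simp: lookup_add lookup_minus lookup_single when_def)

definition vdeg :: "'v set \<Rightarrow> ('v \<Rightarrow>\<^sub>0 nat) \<Rightarrow> nat" where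
  "vdeg Y t = (\<Sum>i\<in>Y. Poly_Mapping.lookup t i)"

lemma vdeg_add: "vdeg Y (s + t) = vdeg Y s + vdeg Y t"
  by (simp add: vdeg_def lookup_add sum.distrib)

lemma vdeg_zero [simp]: "vdeg Y 0 = 0"
  by (simp add: vdeg_def)

definition homog :: "'v set \<Rightarrow> nat \<Rightarrow> (('v \<Rightarrow>\<^sub>0 nat) \<Rightarrow>\<^sub>0 'k::comm_ring_1) \<Rightarrow> bool" where
  "homog Y k p \<longleftrightarrow> (\<forall>t\<in>Poly_Mapping.keys p. vdeg Y t = k)"

lemma homog_mult: "homog Y k p \<Longrightarrow> homog Y l q \<Longrightarrow> homog Y (k + l) (p * q)"
  unfolding homog_def by (metis in_keys_multE vdeg_add)

lemma homog_const: "homog Y 0 (Poly_Mapping.single 0 c)"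
  by (simp add: homog_def)

lemma homog_one: "homog Y 0 1"
  by (simp add: homog_def)

lemma homog_power: "homog Y k p \<Longrightarrow> homog Y (n * k) (p ^ n)"
  by (induction n) (simp_all add: homog_one homog_mult)

lemma homog_prod: "(\<And>i. i \<in> I \<Longrightarrow> homog Y (k i) (p i)) \<Longrightarrow> homog Y (\<Sum>i\<in>I. k i) (\<Prod>i\<in>I. p i)"
  by (induction I rule: infinite_finite_induct) (simp_all add: homog_one homog_mult)

lemma homog_add: "homog Y k p \<Longrightarrow> homog Y k q \<Longrightarrow> homog Y k (p + q)"
  unfolding homog_def using keys_add[of p q] by blast

lemma homog_var: "finite Y \<Longrightarrow> homog Y (if i \<in> Y then 1 else 0) (var i)"
  by (simp add: homog_def var_def vdeg_def lookup_single when_def)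

text \<open>
  A substitution that preserves the degree of each variable introduces no new degrees.
\<close>

lemma keys_subst_vdeg:
  fixes \<phi> :: "'v::finite \<Rightarrow> ('v \<Rightarrow>\<^sub>0 nat) \<Rightarrow>\<^sub>0 'k::comm_ring_1"
  assumes "\<And>i. homog Y (if i \<in> Y then 1 else 0) (\<phi> i)" "t \<in> Poly_Mapping.keys (subst \<phi> p)"
  shows "\<exists>s\<in>Poly_Mapping.keys p. vdeg Y t = vdeg Y s"
proof -
  have h: "homog Y (vdeg Y s) (Poly_Mapping.single 0 c * mon_subst \<phi> s)" for s and c :: 'k
  proof -
    have "homog Y (\<Sum>i\<in>UNIV. Poly_Mapping.lookup s i * (if i \<in> Y then 1 else 0)) (mon_subst \<phi> s)"
      unfolding mon_subst_def by (intro homog_prod homog_power assms)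
    also have "(\<Sum>i\<in>UNIV. Poly_Mapping.lookup s i * (if i \<in> Y then 1 else 0)) = vdeg Y s"
      unfolding vdeg_def by (intro sum.mono_neutral_cong_right) auto
    finally show ?thesis using homog_mult[OF homog_const] by fastforce
  qed
  from assms(2) obtain s where "s \<in> Poly_Mapping.keys p"
    "t \<in> Poly_Mapping.keys (Poly_Mapping.single 0 (Poly_Mapping.lookup p s) * mon_subst \<phi> s)"
    unfolding subst_def by (rule in_keys_sumE)
  with h show ?thesis unfolding homog_def by blast
qed

lemma vdeg_power_ge:
  assumes "\<And>t. t \<in> Poly_Mapping.keys p \<Longrightarrow> k \<le> vdeg Y t" "t \<in> Poly_Mapping.keys (p ^ n)"
  shows "n * k \<le> vdeg Y t"
  using assms(2)
proof (induction n arbitrary: t)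
  case (Suc n)
  then obtain s t' where "t = s + t'" "s \<in> Poly_Mapping.keys p" "t' \<in> Poly_Mapping.keys (p ^ n)"
    by (auto elim: in_keys_multE)
  with Suc.IH[of t'] assms(1)[of s] show ?case by (simp add: vdeg_add)
qed simp

section \<open>Ideals generated by powers of variables\<close>

text \<open>
  The terms divisible by the last power split off as one multiple of it; the remaining terms are left to the
  shorter sequence.
\<close>

lemma gen_ideal_monomials:
  fixes p :: "('v \<Rightarrow>\<^sub>0 nat) \<Rightarrow>\<^sub>0 'k::comm_ring_1"
  shows "p \<in> gen_ideal (\<lambda>i. var (h i) ^ e i) r \<longleftrightarrow>
    (\<forall>t\<in>Poly_Mapping.keys p. \<exists>i<r. e i \<le> Poly_Mapping.lookup t (h i))"
proof (induction r arbitrary: p)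
  case (Suc r)
  show ?case
  proof
    assume "p \<in> gen_ideal (\<lambda>i. var (h i) ^ e i) (Suc r)"
    then obtain q c where q: "q \<in> gen_ideal (\<lambda>i. var (h i) ^ e i) r" "p = q + c * var (h r) ^ e r"
      by (auto simp: gen_ideal_Suc)
    show "\<forall>t\<in>Poly_Mapping.keys p. \<exists>i<Suc r. e i \<le> Poly_Mapping.lookup t (h i)"
    proof
      fix t assume "t \<in> Poly_Mapping.keys p"
      hence "t \<in> Poly_Mapping.keys q \<union> Poly_Mapping.keys (Poly_Mapping.single (Poly_Mapping.single (h r) (e r)) 1 * c)"
        using keys_add[of q "c * var (h r) ^ e r"] q(2) by (auto simp: var_power mult.commute)
      thus "\<exists>i<Suc r. e i \<le> Poly_Mapping.lookup t (h i)"
      proof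
        assume "t \<in> Poly_Mapping.keys q"
        thus ?thesis using q(1) Suc.IH[of q] less_SucI by blast
      next
        assume "t \<in> Poly_Mapping.keys (Poly_Mapping.single (Poly_Mapping.single (h r) (e r)) 1 * c)"
        hence "e r \<le> Poly_Mapping.lookup t (h r)"
          by (auto simp: keys_monomial_mult lookup_add)
        thus ?thesis by blast
      qed
    qed
  next
    assume p: "\<forall>t\<in>Poly_Mapping.keys p. \<exists>i<Suc r. e i \<le> Poly_Mapping.lookup t (h i)"
    let ?A = "\<lambda>t. e r \<le> Poly_Mapping.lookup t (h r)"
    have "\<exists>q. select_terms ?A p = Poly_Mapping.single (Poly_Mapping.single (h r) (e r)) 1 * q"
      by (rule monomial_dvd) (auto simp: keys_select_terms intro: exponent_split)
    then obtain q where "select_terms ?A p = q * var (h r) ^ e r" by (auto simp: var_power mult.commute)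
    hence "p = select_terms (\<lambda>t. \<not> ?A t) p + q * var (h r) ^ e r"
      using select_terms_complement[of ?A p] by (simp add: add.commute)
    moreover have "select_terms (\<lambda>t. \<not> ?A t) p \<in> gen_ideal (\<lambda>i. var (h i) ^ e i) r"
      unfolding Suc.IH using p by (auto simp: keys_select_terms less_Suc_eq)
    ultimately show "p \<in> gen_ideal (\<lambda>i. var (h i) ^ e i) (Suc r)" unfolding gen_ideal_Suc by blast
  qed
qed simp

lemma regular_seq_monomials:
  fixes h :: "nat \<Rightarrow> 'v"
  assumes "inj_on h {..<n}"
  shows "regular_seq (\<lambda>i. (var (h i) :: ('v \<Rightarrow>\<^sub>0 nat) \<Rightarrow>\<^sub>0 'k::comm_ring_1) ^ e i) n"
  unfolding regular_seq_def
proof (intro allI impI)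
  fix r and p :: "('v \<Rightarrow>\<^sub>0 nat) \<Rightarrow>\<^sub>0 'k"
  assume r: "r < n" and "var (h r) ^ e r * p \<in> gen_ideal (\<lambda>i. var (h i) ^ e i) r"
  hence *: "\<forall>t\<in>Poly_Mapping.keys p. \<exists>i<r.
      e i \<le> Poly_Mapping.lookup (Poly_Mapping.single (h r) (e r) + t) (h i)"
    unfolding gen_ideal_monomials by (simp add: var_power keys_monomial_mult)
  have "h r \<noteq> h i" if "i < r" for i
    using inj_onD[OF assms, of r i] r that by auto
  hence "Poly_Mapping.lookup (Poly_Mapping.single (h r) (e r) + t) (h i) = Poly_Mapping.lookup t (h i)"
    if "i < r" for t i using that by (simp add: lookup_add lookup_single when_def)
  with * show "p \<in> gen_ideal (\<lambda>i. var (h i) ^ e i) r"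
    unfolding gen_ideal_monomials by metis
qed

lemma sum_pigeonhole:
  fixes x e :: "nat \<Rightarrow> nat"
  assumes "(\<Sum>i<r. e i) < (\<Sum>i<r. x i)"
  shows "\<exists>i<r. e i < x i"
  using sum_mono[of "{..<r}" x e] assms by (meson lessThan_iff not_le)

section \<open>Forms containing a pure power of a variable\<close>

text \<open>
  A form of degree \<open>b\<close> in the variables \<open>h 0, \<dots>, h N\<close>, over the polynomial ring in the other variables, that has
  a term \<open>t0\<close> divisible by none of \<open>h 0, \<dots>, h (N - 1)\<close>. By homogeneity, \<open>t0\<close> contains exactly the power \<open>b\<close> of \<open>h N\<close>.
\<close>

locale pure_power_form =
  fixes p :: "('v::finite \<Rightarrow>\<^sub>0 nat) \<Rightarrow>\<^sub>0 'k::idom" and h :: "nat \<Rightarrow> 'v" and N b :: nat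
    and t0 :: "'v \<Rightarrow>\<^sub>0 nat"
  assumes inj_h: "inj_on h {..N}"
    and homog_p: "homog (h ` {..N}) b p"
    and b_pos: "0 < b"
    and t0: "t0 \<in> Poly_Mapping.keys p" "\<And>i. i < N \<Longrightarrow> Poly_Mapping.lookup t0 (h i) = 0"
begin

lemma vdeg_h: "vdeg (h ` {..N}) t = (\<Sum>i<N. Poly_Mapping.lookup t (h i)) + Poly_Mapping.lookup t (h N)"
  unfolding vdeg_def by (subst sum.reindex[OF inj_h]) (simp flip: lessThan_Suc_atMost)

lemma vdeg_h': "vdeg (h ` {..<N}) t = (\<Sum>i<N. Poly_Mapping.lookup t (h i))"
  unfolding vdeg_def by (subst sum.reindex) (auto intro: inj_on_subset[OF inj_h])

abbreviation lead_part where
  "lead_part \<equiv> select_terms (\<lambda>t. b \<le> Poly_Mapping.lookup t (h N)) p"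

abbreviation low_part where
  "low_part \<equiv> select_terms (\<lambda>t. \<not> b \<le> Poly_Mapping.lookup t (h N)) p"

lemma key_degrees:
  "t \<in> Poly_Mapping.keys p \<Longrightarrow>
    (\<Sum>i<N. Poly_Mapping.lookup t (h i)) + Poly_Mapping.lookup t (h N) = b"
  using homog_p unfolding homog_def vdeg_h by blast

lemma lead_part_keys:
  assumes "t \<in> Poly_Mapping.keys lead_part"
  shows "Poly_Mapping.lookup t (h N) = b" "i < N \<Longrightarrow> Poly_Mapping.lookup t (h i) = 0"
  using key_degrees[of t] assms by (auto simp: keys_select_terms)

lemma lead_part_nonzero: "lead_part \<noteq> 0"
proof -
  have "t0 \<in> Poly_Mapping.keys lead_part" using key_degrees[OF t0(1)] t0 by (simp add: keys_select_terms)
  thus ?thesis by auto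
qed

text \<open>
  The terms of degree \<open>b\<close> in \<open>z = h N\<close> have the sum \<open>F z\<^sup>b\<close> with \<open>F\<close> free of \<open>h 0, \<dots>, h N\<close>, and every other term contains one of the
  variables \<open>h i\<close> with \<open>i < N\<close>. Modulo \<open>p\<close>, a high power of \<open>F z\<^sup>b\<close> equals, up to sign, that power of the sum of the other terms, which lies in the
  ideal of powers by the pigeonhole principle.
\<close>

lemma lead_power_in_ideal:
  "\<exists>g M c. g \<noteq> 0 \<and> (\<forall>t\<in>Poly_Mapping.keys g. \<forall>i\<le>N. Poly_Mapping.lookup t (h i) = 0) \<and>
    var (h N) ^ M * g - c * p \<in> gen_ideal (\<lambda>i. var (h i) ^ Suc k) N"
proof -
  let ?z = "Poly_Mapping.single (h N) b"
  have "\<exists>F. lead_part = Poly_Mapping.single ?z 1 * F"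
    by (rule monomial_dvd) (auto simp: keys_select_terms intro: exponent_split)
  then obtain F where F: "lead_part = var (h N) ^ b * F" by (auto simp: var_power)
  have F0: "F \<noteq> 0" using lead_part_nonzero F by auto
  have F_keys: "Poly_Mapping.lookup t (h i) = 0" if "t \<in> Poly_Mapping.keys F" "i \<le> N" for t i
  proof -
    have t: "?z + t \<in> Poly_Mapping.keys lead_part"
      unfolding F var_power keys_monomial_mult using that by blast
    show ?thesis
    proof (cases "i = N")
      case True
      thus ?thesis using lead_part_keys(1)[OF t] by (simp add: lookup_add)
    next
      case False
      thus ?thesis using lead_part_keys(2)[OF t, of i] that(2) by (simp add: lookup_add)
    qed
  qed
  \<comment> \<open>A monomial of degree more than \<open>N k\<close> in \<open>N\<close> variables has an exponent greater than \<open>k\<close>.\<close>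
  define L where "L = Suc (N * k)"
  have "p dvd lead_part ^ L - (- low_part) ^ L"
  proof -
    have "lead_part - (- low_part) dvd lead_part ^ L - (- low_part) ^ L"
      by (subst power_diff_sumr2) (rule dvd_triv_left)
    thus ?thesis using select_terms_complement[of "\<lambda>t. b \<le> Poly_Mapping.lookup t (h N)" p] by simp
  qed
  then obtain c where c: "lead_part ^ L - (- low_part) ^ L = p * c" by (elim dvdE)
  have "(- low_part) ^ L \<in> gen_ideal (\<lambda>i. var (h i) ^ Suc k) N"
    unfolding gen_ideal_monomials
  proof
    fix t assume t: "t \<in> Poly_Mapping.keys ((- low_part) ^ L)"
    have "L * 1 \<le> vdeg (h ` {..<N}) t"
    proof (rule vdeg_power_ge[OF _ t])
      fix s assume "s \<in> Poly_Mapping.keys (- low_part)"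
      hence "s \<in> Poly_Mapping.keys low_part" by (simp add: in_keys_iff)
      thus "1 \<le> vdeg (h ` {..<N}) s"
        using key_degrees[of s] by (auto simp: keys_select_terms vdeg_h')
    qed
    hence "(\<Sum>i<N. k) < (\<Sum>i<N. Poly_Mapping.lookup t (h i))" by (simp add: vdeg_h' L_def)
    thus "\<exists>i<N. Suc k \<le> Poly_Mapping.lookup t (h i)" 
      unfolding Suc_le_eq by (rule sum_pigeonhole)
  qed
  moreover have "(- low_part) ^ L = var (h N) ^ (b * L) * F ^ L - c * p"
  proof -
    have "(- low_part) ^ L = lead_part ^ L - c * p" unfolding mult.commute[of c] c[symmetric] by simp
    also have "lead_part ^ L = var (h N) ^ (b * L) * F ^ L"
      unfolding F power_mult_distrib power_mult ..
    finally show ?thesis .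
  qed
  moreover have "\<forall>t\<in>Poly_Mapping.keys (F ^ L). \<forall>i\<le>N. Poly_Mapping.lookup t (h i) = 0"
  proof (intro ballI allI impI)
    fix t i assume t: "t \<in> Poly_Mapping.keys (F ^ L)" and i: "i \<le> N"
    have "homog {h i} 0 F" using F_keys i by (simp add: homog_def vdeg_def)
    hence "homog {h i} (L * 0) (F ^ L)" by (rule homog_power)
    thus "Poly_Mapping.lookup t (h i) = 0" using t by (simp add: homog_def vdeg_def)
  qed
  ultimately show ?thesis using poly_power_nonzero[OF F0, of L]
    by (intro exI[of _ "F ^ L"] exI[of _ "b * L"] exI[of _ c]) simp
qed

text \<open>
  Modulo the powers of the \<open>h i\<close>, the element on the left is not zero and has degree \<open>0\<close> in \<open>z = h N\<close>.
  A multiple \<open>c p\<close> that is not zero modulo them has degree at least \<open>b\<close> in \<open>z\<close>: after reducing \<open>c\<close> to \<open>c'\<close>, its leading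
  coefficient in \<open>z\<close> is that of \<open>c'\<close> times the coefficient of \<open>z\<^sup>b\<close> in \<open>p\<close>. The latter is free of the \<open>h i\<close>, so the product
  stays nonzero modulo their powers.
\<close>

lemma monomial_multiple_not_in_ideal:
  assumes g: "g \<noteq> 0" "\<And>t i. t \<in> Poly_Mapping.keys g \<Longrightarrow> i \<le> N \<Longrightarrow> Poly_Mapping.lookup t (h i) = 0"
    and N: "0 < N"
  shows "var (h 0) ^ k * g * (\<Prod>j<N. var (h j) ^ l) - c * p \<notin> gen_ideal (\<lambda>i. var (h i) ^ (l + Suc k)) N"
proof
  define m where "m = Poly_Mapping.single (h 0) k + (\<Sum>j<N. Poly_Mapping.single (h j) l)"
  define q where "q = Poly_Mapping.single m 1 * g"
  define I where "I t \<longleftrightarrow> (\<exists>i<N. l + Suc k \<le> Poly_Mapping.lookup t (h i))" for t :: "'v \<Rightarrow>\<^sub>0 nat"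
  assume "var (h 0) ^ k * g * (\<Prod>j<N. var (h j) ^ l) - c * p \<in> gen_ideal (\<lambda>i. var (h i) ^ (l + Suc k)) N"
  moreover have "var (h 0) ^ k * g * (\<Prod>j<N. var (h j) ^ l) = q"
  proof -
    have "q = Poly_Mapping.single (Poly_Mapping.single (h 0) k) 1
        * Poly_Mapping.single (\<Sum>j<N. Poly_Mapping.single (h j) l) 1 * g"
      by (simp add: q_def m_def mult_single)
    thus ?thesis by (simp only: var_power prod_monomials mult_ac)
  qed
  ultimately have I: "I t" if "t \<in> Poly_Mapping.keys (q - c * p)" for t
    using that unfolding gen_ideal_monomials I_def by simp
  have h_eq: "h i = h j \<longleftrightarrow> i = j" if "i \<le> N" "j \<le> N" for i j
    using inj_onD[OF inj_h, of i j] that by auto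
  have m: "Poly_Mapping.lookup m (h i) = (if i = 0 then k else 0) + (if i < N then l else 0)" if "i \<le> N" for i
  proof -
    have "(\<Sum>j<N. Poly_Mapping.lookup (Poly_Mapping.single (h j) l) (h i)) = (\<Sum>j<N. if j = i then l else 0)"
      using that by (intro sum.cong) (auto simp: lookup_single when_def h_eq)
    thus ?thesis using h_eq[of i 0] h_eq[of 0 i] that 
      by (auto simp: m_def lookup_add lookup_sum lookup_single when_def)
  qed
  have q_keys: "\<not> I t" "Poly_Mapping.lookup t (h N) = 0" if "t \<in> Poly_Mapping.keys q" for t
  proof -
    from that obtain s where s: "t = m + s" "s \<in> Poly_Mapping.keys g" 
      by (auto simp: q_def keys_monomial_mult)
    show "Poly_Mapping.lookup t (h N) = 0" using m[of N] g(2)[OF s(2)] N by (simp add: s lookup_add)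
    show "\<not> I t" using m g(2)[OF s(2)] by (auto simp: I_def s lookup_add)
  qed
  have "q \<noteq> 0" unfolding q_def using g(1) by (metis image_is_empty keys_eq_empty keys_monomial_mult)
  then obtain tq where tq: "tq \<in> Poly_Mapping.keys q" using keys_eq_empty by blast
  \<comment> \<open>The part of \<open>c\<close> in normal form modulo the ideal.\<close>
  define c' where "c' = select_terms (\<lambda>t. \<not> I t) c"
  have I_add: "I (s + t)" if "I s" for s t using that by (auto simp: I_def lookup_add)
  have I_part: "\<not> Poly_Mapping.lookup (select_terms I c * p) t \<noteq> 0" if "\<not> I t" for t
  proof
    assume "Poly_Mapping.lookup (select_terms I c * p) t \<noteq> 0"
    hence "t \<in> Poly_Mapping.keys (select_terms I c * p)" by (simp add: in_keys_iff)
    then obtain s s' where "t = s + s'" "s \<in> Poly_Mapping.keys (select_terms I c)" by (rule in_keys_multE)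
    thus False using that I_add by (simp add: keys_select_terms)
  qed
  have cp: "Poly_Mapping.lookup (c * p) t = Poly_Mapping.lookup (c' * p) t" if "\<not> I t" for t
  proof -
    have "c * p = select_terms I c * p + c' * p" using select_terms_complement[of I c] by (simp add: c'_def flip: distrib_right)
    thus ?thesis using I_part[OF that] by (simp add: lookup_add)
  qed
  have "c' \<noteq> 0"
  proof
    assume "c' = 0"
    hence "Poly_Mapping.lookup (c * p) tq = 0" using cp[OF q_keys(1)[OF tq]] by simp
    hence "tq \<in> Poly_Mapping.keys (q - c * p)" using tq by (simp add: in_keys_iff lookup_minus)
    thus False using I q_keys(1)[OF tq] by blast
  qed
  let ?zd = "\<lambda>t. Poly_Mapping.lookup t (h N)"
  define D where "D = Max (?zd ` Poly_Mapping.keys c')"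
  have D: "?zd t \<le> D" if "t \<in> Poly_Mapping.keys c'" for t
    using that by (auto simp: D_def)
  have "D \<in> ?zd ` Poly_Mapping.keys c'" unfolding D_def using \<open>c' \<noteq> 0\<close> by (intro Max_in) auto
  then obtain tc where tc: "tc \<in> Poly_Mapping.keys c'" "?zd tc = D" by auto
  define G where "G = select_terms (\<lambda>t. D \<le> ?zd t) c'"
  define G' where "G' = select_terms (\<lambda>t. \<not> D \<le> ?zd t) c'"
  have "tc \<in> Poly_Mapping.keys G" using tc by (simp add: G_def keys_select_terms)
  hence "G \<noteq> 0" by auto
  hence "G * lead_part \<noteq> 0" using lead_part_nonzero by (rule poly_mult_nonzero)
  then obtain t where t: "t \<in> Poly_Mapping.keys (G * lead_part)" using keys_eq_empty by blast
  then obtain s s' where s: "t = s + s'" "s \<in> Poly_Mapping.keys G" "s' \<in> Poly_Mapping.keys lead_part"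
    by (rule in_keys_multE)
  have sI: "\<not> I s" using s(2) by (simp add: G_def c'_def keys_select_terms)
  have tI: "\<not> I t"
    using sI lead_part_keys(2)[OF s(3)] by (auto simp: I_def s(1) lookup_add)
  have "?zd s = D" using s(2) D by (auto simp: G_def keys_select_terms intro: antisym)
  hence zt: "?zd t = D + b" using lead_part_keys(1)[OF s(3)] by (simp add: s(1) lookup_add)
  have small: "Poly_Mapping.lookup (A * B) t = 0"
    if "\<And>s s'. s \<in> Poly_Mapping.keys A \<Longrightarrow> s' \<in> Poly_Mapping.keys B \<Longrightarrow> ?zd s + ?zd s' < D + b" for A B
  proof (rule ccontr)
    assume "Poly_Mapping.lookup (A * B) t \<noteq> 0"
    hence "t \<in> Poly_Mapping.keys (A * B)" by (simp add: in_keys_iff)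
    then obtain s s' where "t = s + s'" "s \<in> Poly_Mapping.keys A" "s' \<in> Poly_Mapping.keys B"
      by (rule in_keys_multE)
    thus False using that[of s s'] zt by (simp add: lookup_add)
  qed
  have G'_low: "?zd s < D" if "s \<in> Poly_Mapping.keys G'" for s
    using that by (auto simp: G'_def keys_select_terms)
  have G_le: "?zd s \<le> D" if "s \<in> Poly_Mapping.keys G" for s
    using that D by (auto simp: G_def keys_select_terms)
  have p_le: "?zd s \<le> b" if "s \<in> Poly_Mapping.keys p" for s
    using key_degrees[OF that] by simp
  have "G * p = G * (lead_part + low_part)" by (simp only: select_terms_complement)
  moreover have "c' * p = (G + G') * p" by (simp only: G_def G'_def select_terms_complement)
  ultimately have "c' * p = G * lead_part + (G * low_part + G' * p)"
    by (simp only: distrib_left distrib_right add.assoc)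
  moreover have "Poly_Mapping.lookup (G * low_part) t = 0"
  proof (rule small)
    fix s s' assume "s \<in> Poly_Mapping.keys G" "s' \<in> Poly_Mapping.keys low_part"
    thus "?zd s + ?zd s' < D + b" using G_le[of s] by (simp add: keys_select_terms)
  qed
  moreover have "Poly_Mapping.lookup (G' * p) t = 0"
  proof (rule small)
    fix s s' assume "s \<in> Poly_Mapping.keys G'" "s' \<in> Poly_Mapping.keys p"
    thus "?zd s + ?zd s' < D + b" using G'_low[of s] p_le[of s'] by simp
  qed
  ultimately have "Poly_Mapping.lookup (c' * p) t \<noteq> 0" using t by (simp add: lookup_add in_keys_iff)
  hence "Poly_Mapping.lookup (c * p) t \<noteq> 0" using cp[OF tI] by simp
  moreover have "Poly_Mapping.lookup q t = 0"
    using q_keys(2)[of t] zt b_pos by (auto simp: in_keys_iff)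
  ultimately have "t \<in> Poly_Mapping.keys (q - c * p)" by (simp add: in_keys_iff lookup_minus)
  thus False using I tI by blast
qed

end

section \<open>A linear change of coordinates producing a pure power\<close>

lemma gen_ideal_subst:
  assumes "p \<in> gen_ideal u r"
  shows "subst \<phi> p \<in> gen_ideal (\<lambda>i. subst \<phi> (u i)) r"
proof -
  from assms obtain c where "p = (\<Sum>i<r. c i * u i)" unfolding gen_ideal_def by blast
  hence "subst \<phi> p = (\<Sum>i<r. subst \<phi> (c i) * subst \<phi> (u i))" by (simp add: subst_sum subst_mult)
  thus ?thesis unfolding gen_ideal_def by (intro CollectI exI[of _ "\<lambda>i. subst \<phi> (c i)"]) simp
qed

lemma sum_over_sum_type:
  "(\<Sum>i\<in>(UNIV :: ('m::finite + 'n::finite) set). g i) = (\<Sum>i\<in>UNIV. g (Inl i)) + (\<Sum>j\<in>UNIV. g (Inr j))"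
  using sum.Plus[of "UNIV :: 'm set" "UNIV :: 'n set" g] by (simp add: comp_def)

lemma monomial_power:
  "(Poly_Mapping.single s (1::'k::comm_semiring_1)) ^ n = Poly_Mapping.single (\<Sum>_<n. s) 1"
  using prod_monomials[of "\<lambda>_. s" "{..<n}", where 'k = 'k] by simp

text \<open>
  The substitution \<open>y\<^sub>j \<mapsto> y\<^sub>j + s x\<^bsup>w j\<^esup> y\<^sub>z\<close> for \<open>j \<noteq> z\<close>, with \<open>undefined\<close> as an arbitrary choice of the variable \<open>x\<close>. The
  sign \<open>s\<close> is a parameter, so that the inverse is a substitution of the same shape.
\<close>

definition shear :: "('n \<Rightarrow> nat) \<Rightarrow> 'n \<Rightarrow> ('m::finite, 'n::finite, 'k::field) bipoly \<Rightarrow>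
    'm + 'n \<Rightarrow> ('m, 'n, 'k) bipoly" where
  "shear w z s i = (case i of Inl _ \<Rightarrow> var i
     | Inr j \<Rightarrow> if j = z then var i else var i + s * (var (Inl undefined) ^ w j * var (Inr z)))"

lemma shear_inverse:
  assumes "subst (shear w z (- s)) s = s"
  shows "subst (shear w z (- s)) (subst (shear w z s) p) = p"
proof -
  have "subst (shear w z (- s)) (shear w z s i) = var i" for i
    using assms by (cases i) (auto simp: shear_def subst_add subst_mult subst_power)
  thus ?thesis by (simp add: subst_subst)
qed

lemma homog_shear:
  assumes "homog (range Inr) 0 s"
  shows "homog (range Inr) (if i \<in> range Inr then 1 else 0)
    (shear w z s i :: ('m::finite, 'n::finite, 'k::field) bipoly)"
proof -
  let ?Y = "range Inr :: ('m + 'n) set"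
  have v: "homog ?Y (if i \<in> ?Y then 1 else 0) (var i)" for i by (rule homog_var) simp
  have "homog ?Y (0 + (w j * 0 + 1)) (s * (var (Inl undefined) ^ w j * var (Inr z)))" for j
  proof (intro homog_mult homog_power assms)
    have "Inl undefined \<notin> ?Y" by auto
    thus "homog ?Y 0 (var (Inl undefined))" using v[of "Inl undefined"] by (simp only: if_False)
    show "homog ?Y 1 (var (Inr z))" using v[of "Inr z"] by simp
  qed
  thus ?thesis using v[of i]
    by (cases i) (auto simp: shear_def intro!: homog_add)
qed

text \<open>
  Composing the substitution with \<open>y\<^sub>j \<mapsto> 0\<close> for \<open>j \<noteq> z\<close> gives \<open>y\<^sub>j \<mapsto> x\<^bsup>w j\<^esup> y\<^sub>z\<close>, which maps monomials to
  monomials. All monomials of \<open>f\<close> have the same degree in the \<open>x\<^sub>i\<close> and the same degree in the \<open>y\<^sub>j\<close>. So the image of a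
  monomial \<open>t\<close> determines its exponents at the \<open>x\<^sub>i\<close>, and then the sum of the \<open>w j * t j\<close>. A separating \<open>w\<close> therefore makes
  the map injective on the monomials of \<open>f\<close>.
  Hence the image of \<open>f\<close> is not zero, and the substituted \<open>f\<close> has a term free of all \<open>y\<^sub>j\<close> with \<open>j \<noteq> z\<close>.
\<close>

lemma exists_shear:
  fixes f :: "('m::finite, 'n::finite, 'k::field) bipoly"
  assumes f: "bihomogeneous (a, b) f" "f \<noteq> 0"
  shows "\<exists>w. \<exists>t\<in>Poly_Mapping.keys (subst (shear w z 1) f). \<forall>j. j \<noteq> z \<longrightarrow> Poly_Mapping.lookup t (Inr j) = 0"
proof -
  let ?K = "Poly_Mapping.keys f" and ?l = "Poly_Mapping.lookup"
  obtain w where w: "\<And>s t. \<lbrakk>s \<in> ?K; t \<in> ?K;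
      (\<Sum>j\<in>-{z}. w j * ?l s (Inr j)) = (\<Sum>j\<in>-{z}. w j * ?l t (Inr j))\<rbrakk> \<Longrightarrow>
      \<forall>j\<in>-{z}. ?l s (Inr j) = ?l t (Inr j)"
    using separating_weights[of "(\<lambda>t j. ?l t (Inr j)) ` ?K" "-{z}"] by auto
  define u :: "'m + 'n" where "u = Inl undefined"
  \<comment> \<open>\<open>\<rho>\<close> sets all \<open>y\<^sub>j\<close> with \<open>j \<noteq> z\<close> to zero, \<open>e\<close> gives the exponents of the images of the variables under the
    composition, and \<open>\<Theta>\<close> those of the images of monomials.\<close>
  define \<rho> :: "'m + 'n \<Rightarrow> ('m, 'n, 'k) bipoly" where
    "\<rho> i = (case i of Inl _ \<Rightarrow> var i | Inr j \<Rightarrow> if j = z then var i else 0)" for i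
  define e :: "'m + 'n \<Rightarrow> ('m, 'n) bimonom" where
    "e i = (case i of Inl _ \<Rightarrow> Poly_Mapping.single i 1
      | Inr j \<Rightarrow> Poly_Mapping.single (Inr z) 1 + (if j = z then 0 else Poly_Mapping.single u (w j)))" for i
  define \<Theta> where "\<Theta> t = (\<Sum>i\<in>UNIV. \<Sum>_<?l t i. e i)" for t :: "('m, 'n) bimonom"
  have "subst \<rho> (shear w z 1 i) = Poly_Mapping.single (e i) 1" for i
  proof -
    have "subst \<rho> (shear w z 1 i) = (case i of Inl _ \<Rightarrow> var i
        | Inr j \<Rightarrow> if j = z then var i else var u ^ w j * var (Inr z))"
      by (cases i) (auto simp: shear_def \<rho>_def u_def subst_add subst_mult subst_power)
    also have "\<dots> = Poly_Mapping.single (e i) 1"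
      by (cases i) (auto simp: e_def var_power mult_single add.commute
          var_def[of "Inl i'" for i'] var_def[of "Inr j" for j])
    finally show ?thesis .
  qed
  hence \<rho>\<tau>: "subst \<rho> (subst (shear w z 1) f) = subst (\<lambda>i. Poly_Mapping.single (e i) 1) f"
    by (simp add: subst_subst)
  have "mon_subst (\<lambda>i. Poly_Mapping.single (e i) 1) t = Poly_Mapping.single (\<Theta> t) (1::'k)" for t
    by (simp add: mon_subst_def monomial_power prod_monomials \<Theta>_def)
  hence eq: "subst \<rho> (subst (shear w z 1) f) = (\<Sum>t\<in>?K. Poly_Mapping.single (\<Theta> t) (?l f t))"
    by (subst \<rho>\<tau>, subst subst_def) (simp add: mult_single)
  have \<Theta>: "?l (\<Theta> t) v = (\<Sum>i\<in>UNIV. ?l t (Inl i) * ?l (e (Inl i)) v) + (\<Sum>j\<in>UNIV. ?l t (Inr j) * ?l (e (Inr j)) v)"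
    for t v by (simp add: \<Theta>_def lookup_sum lookup_add sum_over_sum_type)
  have deg: "(\<Sum>i\<in>UNIV. ?l t (Inl i)) = a" "(\<Sum>j\<in>UNIV. ?l t (Inr j)) = b" if "t \<in> ?K" for t
    using f(1) that by (auto simp: bihomogeneous_def bidegree_def)
  have \<Theta>_inl: "?l (\<Theta> t) (Inl i) = ?l t (Inl i) +
      (if Inl i = u then \<Sum>j\<in>-{z}. w j * ?l t (Inr j) else 0)" for t i
  proof -
    have "(\<Sum>i'\<in>UNIV. ?l t (Inl i') * ?l (e (Inl i')) (Inl i)) = (\<Sum>i'\<in>UNIV. if i' = i then ?l t (Inl i) else 0)"
      by (intro sum.cong) (auto simp: e_def lookup_single when_def)
    moreover have "(\<Sum>j\<in>UNIV. ?l t (Inr j) * ?l (e (Inr j)) (Inl i)) =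
        (\<Sum>j\<in>-{z}. if Inl i = u then w j * ?l t (Inr j) else 0)"
      by (intro sum.mono_neutral_cong_right)
        (auto simp: e_def lookup_add lookup_single when_def u_def)
    ultimately show ?thesis unfolding \<Theta> by simp
  qed
  have \<Theta>_inj: "s = t" if st: "s \<in> ?K" "t \<in> ?K" "\<Theta> s = \<Theta> t" for s t
  proof -
    have other: "?l s (Inl i) = ?l t (Inl i)" if "Inl i \<noteq> u" for i
      using \<Theta>_inl[of s i] \<Theta>_inl[of t i] st(3) that by simp
    have "?l s (Inl undefined) + (\<Sum>i\<in>-{undefined}. ?l s (Inl i)) = a" 
      "?l t (Inl undefined) + (\<Sum>i\<in>-{undefined}. ?l t (Inl i)) = a"
      using deg(1)[OF st(1)] deg(1)[OF st(2)]
      by (simp_all add: sum.remove[of UNIV undefined] Compl_eq_Diff_UNIV)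
    moreover have "(\<Sum>i\<in>-{undefined}. ?l s (Inl i)) = (\<Sum>i\<in>-{undefined}. ?l t (Inl i))"
      by (intro sum.cong) (auto intro: other simp: u_def)
    ultimately have und: "?l s (Inl undefined) = ?l t (Inl undefined)" by simp
    have inl: "?l s (Inl i) = ?l t (Inl i)" for i
      using other[of i] und by (cases "i = undefined") (auto simp: u_def)
    have "(\<Sum>j\<in>-{z}. w j * ?l s (Inr j)) = (\<Sum>j\<in>-{z}. w j * ?l t (Inr j))"
      using \<Theta>_inl[of s undefined] \<Theta>_inl[of t undefined] st(3) und by (simp add: u_def)
    from w[OF st(1,2) this] have inr: "?l s (Inr j) = ?l t (Inr j)" if "j \<noteq> z" for j
      using that by simp
    have "?l s (Inr z) + (\<Sum>i\<in>-{z}. ?l s (Inr i)) = b" "?l t (Inr z) + (\<Sum>i\<in>-{z}. ?l t (Inr i)) = b"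
      using deg(2)[OF st(1)] deg(2)[OF st(2)]
      by (simp_all add: sum.remove[of UNIV z] Compl_eq_Diff_UNIV)
    moreover have "(\<Sum>i\<in>-{z}. ?l s (Inr i)) = (\<Sum>i\<in>-{z}. ?l t (Inr i))"
      by (intro sum.cong) (auto intro: inr)
    ultimately have "?l s (Inr z) = ?l t (Inr z)" by simp
    hence "?l s (Inr j) = ?l t (Inr j)" for j using inr[of j] by (cases "j = z") auto
    with inl have "?l s i = ?l t i" for i by (cases i) auto
    thus ?thesis by (intro poly_mapping_eqI)
  qed
  obtain t1 where t1: "t1 \<in> ?K" using f(2) keys_eq_empty by blast
  have "?l (subst \<rho> (subst (shear w z 1) f)) (\<Theta> t1) = (\<Sum>t\<in>?K. if t = t1 then ?l f t else 0)"
    unfolding eq lookup_sum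
    by (intro sum.cong) (use t1 \<Theta>_inj in \<open>auto simp: lookup_single when_def\<close>)
  also have "\<dots> \<noteq> 0" using t1 by (simp add: in_keys_iff)
  finally have "subst \<rho> (subst (shear w z 1) f) \<noteq> 0" by auto
  then obtain t where t: "t \<in> Poly_Mapping.keys (subst (shear w z 1) f)" "mon_subst \<rho> t \<noteq> 0"
    unfolding subst_def[of \<rho>] by (metis (no_types, lifting) mult_zero_right sum.neutral)
  have "?l t (Inr j) = 0" if "j \<noteq> z" for j
  proof (rule ccontr)
    assume "?l t (Inr j) \<noteq> 0"
    hence "\<rho> (Inr j) ^ ?l t (Inr j) = 0" using that by (simp add: \<rho>_def power_0_left)
    hence "mon_subst \<rho> t = 0" unfolding mon_subst_def by (intro prod_zero) auto
    thus False using t(2) by simp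
  qed
  with t(1) show ?thesis by blast
qed

section \<open>Powers of the ideal generated by the second set of variables\<close>

lemma bipoly_ring_eq: "bipoly_ring = class_ring"
  by (simp add: bipoly_ring_def class_ring_def)

lemma y_ideal_ideal: "ideal y_ideal (class_ring :: ('m::finite, 'n::finite, 'k::field) bipoly ring)"
  unfolding y_ideal_def bipoly_ring_eq by (rule ring.genideal_ideal[OF cring.axioms(1)[OF cring_class_ring]]) simp

lemma y_in_y_ideal: "var (Inr j) \<in> y_ideal"
proof -
  have "range y_var \<subseteq> (y_ideal :: ('m::finite, 'n::finite, 'k::field) bipoly set)"
    unfolding y_ideal_def bipoly_ring_eq
    by (rule ring.genideal_self[OF cring.axioms(1)[OF cring_class_ring]]) simp
  thus ?thesis by (auto simp: y_var_def var_def)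
qed

lemma class_ring_ideal_closed:
  assumes "ideal I (class_ring :: 'r::comm_ring_1 ring)"
  shows "p \<in> I \<Longrightarrow> q \<in> I \<Longrightarrow> p + q \<in> I" "p \<in> I \<Longrightarrow> s * p \<in> I"
proof -
  interpret ideal I class_ring by fact
  show "p \<in> I \<Longrightarrow> q \<in> I \<Longrightarrow> p + q \<in> I" 
    using additive_subgroup.a_closed[OF ideal.axioms(1)[OF assms], of p q] by simp
  show "p \<in> I \<Longrightarrow> s * p \<in> I" using I_l_closed[of p s] by simp
qed

lemma shear_in_y_ideal: "shear w z s (Inr j) \<in> y_ideal"
  using y_in_y_ideal
  by (auto simp: shear_def intro!: class_ring_ideal_closed[OF y_ideal_ideal])

lemma y_ideal_power_vdeg:
  fixes p :: "('m::finite, 'n::finite, 'k::field) bipoly"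
  assumes "p \<in> y_ideal [^]\<^bsub>ideals_set class_ring\<^esub> (k::nat)" "t \<in> Poly_Mapping.keys p"
  shows "k \<le> vdeg (range Inr) t"
proof -
  let ?Y = "range Inr :: ('m + 'n) set"
  define D where "D k = {p :: ('m, 'n, 'k) bipoly. \<forall>t\<in>Poly_Mapping.keys p. k \<le> vdeg ?Y t}" for k
  have D_add: "p + q \<in> D k" if "p \<in> D k" "q \<in> D k" for p q k
    using that keys_add[of p q] unfolding D_def by blast
  have D_mult: "p * q \<in> D (k + l)" if "p \<in> D k" "q \<in> D l" for p q k l
    using that unfolding D_def by (auto elim!: in_keys_multE simp: vdeg_add add_mono)
  have D_smult: "s * p \<in> D k" if "p \<in> D k" for s p k
    using D_mult[of s 0 p k] that by (simp add: D_def)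
  have "ideal (D 1) (class_ring :: ('m, 'n, 'k) bipoly ring)"
  proof (rule idealI)
    interpret R: cring "class_ring :: ('m, 'n, 'k) bipoly ring" by (rule cring_class_ring)
    show "ring (class_ring :: ('m, 'n, 'k) bipoly ring)" by (rule R.ring_axioms)
    show "subgroup (D 1) (add_monoid (class_ring :: ('m, 'n, 'k) bipoly ring))"
    proof (rule R.add.subgroupI)
      show "D 1 \<noteq> {}" by (auto simp: D_def intro: exI[of _ 0])
      show "\<ominus>\<^bsub>class_ring\<^esub> p \<in> D 1" if "p \<in> D 1" for p
      proof -
        have "\<ominus>\<^bsub>class_ring\<^esub> p = (-1) * p" using R.minus_equality[of "- p" p] by simp
        thus ?thesis using D_smult[OF that, of "-1"] by (simp only:)
      qed
    qed (use D_add in auto)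
  qed (use D_smult in \<open>auto simp: mult.commute\<close>)
  moreover have "range y_var \<subseteq> D 1"
    by (auto simp: D_def y_var_def vdeg_def lookup_single when_def)
  ultimately have y: "y_ideal \<subseteq> D 1"
    unfolding y_ideal_def bipoly_ring_eq
    by (rule ring.genideal_minimal[OF cring.axioms(1)[OF cring_class_ring]])
  have "y_ideal [^]\<^bsub>ideals_set class_ring\<^esub> k \<subseteq> D k"
  proof (induction k)
    case 0
    show ?case by (auto simp: D_def)
  next
    case (Suc k)
    show ?case
    proof
      fix p :: "('m, 'n, 'k) bipoly" assume "p \<in> y_ideal [^]\<^bsub>ideals_set class_ring\<^esub> Suc k"
      hence "p \<in> ideal_prod class_ring (y_ideal [^]\<^bsub>ideals_set class_ring\<^esub> k) y_ideal"
        by (simp only: ideal_power_simps)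
      thus "p \<in> D (Suc k)"
      proof induction
        case (prod i j)
        thus ?case using Suc y D_mult[of i k j 1] by auto
      next
        case (sum s1 s2)
        thus ?case using D_add by simp
      qed
    qed
  qed
  thus ?thesis using assms by (auto simp: D_def)
qed

section \<open>The hypersurface ring and its local cohomology\<close>

text \<open>
  The element \<open>\<eta>\<close> is the image of the coset of \<open>1\<close>; it generates the image of \<open>S/fS\<close>, and its annihilator
  is \<open>fS\<close> because the augmentation is injective.
\<close>

lemma injective_resolution_hypersurface:
  fixes f :: "'r::comm_ring_1" and \<epsilon> :: "'r set \<Rightarrow> 'e"
  assumes res: "injective_resolution class_ring (quot_ring_module class_ring (PIdl\<^bsub>class_ring\<^esub> f)) \<epsilon> E d"
  shows "\<exists>\<eta>. injective_hypersurface_complex E d \<eta> f"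
proof -
  let ?R = "class_ring :: 'r ring"
  interpret R: cring ?R by (rule cring_class_ring)
  define I where "I = PIdl\<^bsub>?R\<^esub> f"
  interpret I: ideal I ?R unfolding I_def by (rule R.cgenideal_ideal) simp
  have I_mem: "s \<in> I \<longleftrightarrow> f dvd s" for s
    by (auto simp: I_def cgenideal_def dvd_def mult.commute)
  let ?M = "quot_ring_module ?R I"
  have M_simps: "carrier ?M = a_rcosets\<^bsub>?R\<^esub> I"
    "r \<odot>\<^bsub>?M\<^esub> X = rcoset_mult ?R I (I +>\<^bsub>?R\<^esub> r) X" for r X
    by (simp_all add: quot_ring_module_def ring.defs FactRing_def)
  have coset: "(I +>\<^bsub>?R\<^esub> s) \<in> carrier ?M" for s
    by (simp add: M_simps R.a_rcosetsI I.a_subset)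
  have M_carrier: "carrier ?M = range (\<lambda>s. I +>\<^bsub>?R\<^esub> s)"
    unfolding M_simps by (simp add: A_RCOSETS_def' a_r_coset_def' image_def) blast
  have smult_coset: "s \<odot>\<^bsub>?M\<^esub> (I +>\<^bsub>?R\<^esub> 1) = I +>\<^bsub>?R\<^esub> s" for s
    using I.rcoset_mult_add[of s 1] by (simp add: M_simps)
  note res' = res[folded I_def, unfolded injective_resolution_def]
  have inj: "injective_module ?R (E i)" and maps: "d i \<in> module_maps ?R (E i) (E (Suc i))" for i
    using res' by blast+
  have \<epsilon>: "\<epsilon> \<in> module_maps ?R ?M (E 0)" "inj_on \<epsilon> (carrier ?M)"
    "\<epsilon> ` carrier ?M = a_kernel (E 0) (E 1) (d 0)" using res' by simp_all
  have exact: "d i ` carrier (E i) = a_kernel (E (Suc i)) (E (Suc (Suc i))) (d (Suc i))" for i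
    using res' by blast
  have mod: "module ?R (E i)" for i using inj[of i] by (simp add: injective_module_def)
  define \<eta> where "\<eta> = \<epsilon> (I +>\<^bsub>?R\<^esub> 1)"
  have \<eta>: "\<eta> \<in> carrier (E 0)" using \<epsilon>(1) coset by (auto simp: \<eta>_def module_maps_def)
  have \<epsilon>_coset: "\<epsilon> (I +>\<^bsub>?R\<^esub> s) = s \<odot>\<^bsub>E 0\<^esub> \<eta>" for s
    unfolding \<eta>_def smult_coset[of s, symmetric] using \<epsilon>(1) coset by (simp add: module_maps_def)
  have "injective_hypersurface_complex E d \<eta> f"
  proof
    fix x assume x: "x \<in> carrier (E 0)"
    have "d 0 x = \<zero>\<^bsub>E 1\<^esub> \<longleftrightarrow> x \<in> \<epsilon> ` carrier ?M" using x unfolding \<epsilon>(3) a_kernel_def' by simp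
    also have "\<dots> \<longleftrightarrow> (\<exists>s. x = s \<odot>\<^bsub>E 0\<^esub> \<eta>)" unfolding M_carrier image_image \<epsilon>_coset by blast
    finally show "d 0 x = \<zero>\<^bsub>E 1\<^esub> \<longleftrightarrow> (\<exists>s. x = s \<odot>\<^bsub>E 0\<^esub> \<eta>)" .
  next
    fix s
    have zero: "\<zero>\<^bsub>E 0\<^esub> = \<epsilon> (I +>\<^bsub>?R\<^esub> 0)"
      unfolding \<epsilon>_coset by (rule module_class_ringD(8)[OF mod \<eta>, symmetric])
    have "s \<odot>\<^bsub>E 0\<^esub> \<eta> = \<zero>\<^bsub>E 0\<^esub> \<longleftrightarrow> I +>\<^bsub>?R\<^esub> s = I +>\<^bsub>?R\<^esub> 0"
      unfolding zero \<epsilon>_coset[symmetric] by (rule inj_on_eq_iff[OF \<epsilon>(2) coset coset])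
    also have "I +>\<^bsub>?R\<^esub> 0 = I" using R.a_coset_add_zero[of I] I.a_subset by simp
    also have "I +>\<^bsub>?R\<^esub> s = I \<longleftrightarrow> s \<in> I"
      using I.a_rcos_const[of s] I.a_rcos_self[of s] by auto
    finally show "s \<odot>\<^bsub>E 0\<^esub> \<eta> = \<zero>\<^bsub>E 0\<^esub> \<longleftrightarrow> f dvd s" unfolding I_mem .
  next
    fix x i assume x: "x \<in> carrier (E (Suc i))"
    show "d (Suc i) x = \<zero>\<^bsub>E (Suc (Suc i))\<^esub> \<longleftrightarrow> (\<exists>w\<in>carrier (E i). x = d i w)"
      using exact[of i] x unfolding a_kernel_def' by blast
  qed (use inj maps \<eta> in auto)
  thus ?thesis by blast
qed

theorem proposition3p1:
  fixes f :: "('m::finite, 'n::finite, 'k::field) bipoly"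
    and a b :: nat
    and \<epsilon> :: "('m, 'n, 'k) bipoly set \<Rightarrow> 'e"
    and E :: "nat \<Rightarrow> (('m, 'n, 'k) bipoly, 'e) module"
    and d :: "nat \<Rightarrow> 'e \<Rightarrow> 'e"
  assumes "CARD('n) \<ge> 2"
    and "bihomogeneous (a, b) f" and "f \<noteq> 0" and "b \<ge> 1"
    and "injective_resolution bipoly_ring
           (quot_ring_module bipoly_ring (PIdl\<^bsub>bipoly_ring\<^esub> f)) \<epsilon> E d"
  shows "\<not> finitely_generated bipoly_ring
           (local_cohomology bipoly_ring y_ideal E d (CARD('n) - 1))"
proof
  assume "finitely_generated bipoly_ring (local_cohomology bipoly_ring y_ideal E d (CARD('n) - 1))"
  moreover define q where "q = CARD('n) - 2"
  have q: "CARD('n) = Suc (Suc q)" using assms(1) unfolding q_def by linarith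
  ultimately have fg: "finitely_generated class_ring (local_cohomology class_ring y_ideal E d (Suc q))"
    unfolding bipoly_ring_eq q diff_Suc_1 by blast
  obtain \<eta> where "injective_hypersurface_complex E d \<eta> f"
    using injective_resolution_hypersurface assms(5) unfolding bipoly_ring_eq by blast
  then interpret C: injective_hypersurface_complex E d \<eta> f .
  let ?N = "Suc q"
  obtain h0 :: "nat \<Rightarrow> 'n" where h0: "bij_betw h0 {0..<card (UNIV :: 'n set)} UNIV"
    using ex_bij_betw_nat_finite[OF finite, of "UNIV :: 'n set"] by blast
  have "{0..<card (UNIV :: 'n set)} = {..?N}" unfolding q by auto
  with h0 have h0_inj: "inj_on h0 {..?N}" and h0_surj: "h0 ` {..?N} = UNIV"
    by (auto simp only: bij_betw_def)
  define h :: "nat \<Rightarrow> 'm + 'n" where "h i = Inr (h0 i)" for i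
  have h_inj: "inj_on h {..?N}" using h0_inj by (auto simp: h_def inj_on_def)
  have h_img: "h ` {..?N} = range Inr"
    unfolding h_def image_image[of Inr h0, symmetric] h0_surj ..
  define z where "z = h0 ?N"
  obtain w t0 where t0: "t0 \<in> Poly_Mapping.keys (subst (shear w z 1) f)"
    "\<And>j. j \<noteq> z \<Longrightarrow> Poly_Mapping.lookup t0 (Inr j) = 0"
    using exists_shear[OF assms(2,3), of z] by blast
  \<comment> \<open>\<open>\<tau>\<close> expresses a polynomial in the new coordinates, and \<open>\<sigma>\<close> is its inverse.\<close>
  define \<tau> where "\<tau> = subst (shear w z 1 :: 'm + 'n \<Rightarrow> ('m, 'n, 'k) bipoly)"
  define \<sigma> where "\<sigma> = subst (shear w z (-1) :: 'm + 'n \<Rightarrow> ('m, 'n, 'k) bipoly)"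
  have \<sigma>\<tau>: "\<sigma> (\<tau> p) = p" and \<tau>\<sigma>: "\<tau> (\<sigma> p) = p" for p
    unfolding \<sigma>_def \<tau>_def using shear_inverse[of w z 1 p] shear_inverse[of w z "-1" p]
    by (simp_all add: subst_uminus)
  have \<tau>_homog: "\<exists>s\<in>Poly_Mapping.keys p. vdeg (range Inr) t = vdeg (range Inr) s"
    if "t \<in> Poly_Mapping.keys (\<tau> p)" for t p
    using keys_subst_vdeg[of "range Inr" "shear w z 1", OF homog_shear[OF homog_one]] that
    unfolding \<tau>_def by blast
  interpret P: pure_power_form "\<tau> f" h ?N b t0
  proof
    show "homog (h ` {..?N}) b (\<tau> f)" unfolding h_img homog_def
    proof
      fix t assume "t \<in> Poly_Mapping.keys (\<tau> f)"
      then obtain s where s: "s \<in> Poly_Mapping.keys f" "vdeg (range Inr) t = vdeg (range Inr) s"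
        using \<tau>_homog by blast
      have "vdeg (range Inr) s = (\<Sum>j\<in>UNIV. Poly_Mapping.lookup s (Inr j))"
        unfolding vdeg_def by (subst sum.reindex) (auto simp: inj_on_def)
      thus "vdeg (range Inr) t = b" using s assms(2) by (auto simp: bihomogeneous_def bidegree_def)
    qed
    show "Poly_Mapping.lookup t0 (h i) = 0" if "i < ?N" for i
      using t0(2)[of "h0 i"] inj_onD[OF h0_inj, of i ?N] that by (auto simp: h_def z_def)
  qed (use h_inj t0 assms(4) \<tau>_def in auto)
  define v where "v i = \<sigma> (var (h i))" for i
  have \<sigma>_hom: "\<sigma> (p * p') = \<sigma> p * \<sigma> p'" "\<sigma> (p - p') = \<sigma> p - \<sigma> p'" "\<sigma> (p ^ n) = \<sigma> p ^ n" for p p' n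
    by (simp_all add: \<sigma>_def subst_mult subst_diff subst_power)
  have \<tau>_hom: "\<tau> (p * p') = \<tau> p * \<tau> p'" "\<tau> (p - p') = \<tau> p - \<tau> p'" "\<tau> (p ^ n) = \<tau> p ^ n"
    "\<tau> (\<Prod>i\<in>I. x i) = (\<Prod>i\<in>I. \<tau> (x i))" for p p' n I and x :: "nat \<Rightarrow> _"
    by (simp_all add: \<tau>_def subst_mult subst_diff subst_power subst_prod)
  have \<sigma>_gen: "\<sigma> p \<in> gen_ideal (\<lambda>j. v j ^ e j) r" if "p \<in> gen_ideal (\<lambda>j. var (h j) ^ e j) r" for p e r
    using gen_ideal_subst[OF that, of "shear w z (-1)"] unfolding v_def \<sigma>_def subst_power .
  have \<tau>_gen: "\<tau> p \<in> gen_ideal (\<lambda>j. var (h j) ^ e j) r" if "p \<in> gen_ideal (\<lambda>j. v j ^ e j) r" for p e r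
    using gen_ideal_subst[OF that, of "shear w z 1"]
    unfolding \<tau>_def[symmetric] \<tau>_hom(3) v_def \<tau>\<sigma> .
  have v_Q: "v j \<in> y_ideal" for j
    by (simp add: v_def \<sigma>_def h_def shear_in_y_ideal)
  let ?T = "\<lambda>i. torsion class_ring y_ideal (E i)"
  obtain k where k: "\<And>x. \<lbrakk>x \<in> ?T ?N; d ?N x = \<zero>\<^bsub>E (Suc ?N)\<^esub>\<rbrakk> \<Longrightarrow> v 0 ^ k \<odot>\<^bsub>E ?N\<^esub> x \<in> d q ` ?T q"
    using C.local_cohomology_bound[OF y_ideal_ideal v_Q[of 0] fg] by blast
  obtain g M c where g: "g \<noteq> 0"
    "\<And>t i. t \<in> Poly_Mapping.keys g \<Longrightarrow> i \<le> ?N \<Longrightarrow> Poly_Mapping.lookup t (h i) = 0"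
    "var (h ?N) ^ M * g - c * \<tau> f \<in> gen_ideal (\<lambda>i. var (h i) ^ Suc k) ?N"
    using P.lead_power_in_ideal[of k] by blast
  have "\<exists>l c. v 0 ^ k * \<sigma> g * (\<Prod>j<Suc q. v j ^ l) - c * f \<in> gen_ideal (\<lambda>j. v j ^ (l + Suc k)) (Suc q)"
  proof (rule C.uniform_power_imp_membership[where T = ?T and M = M and c = "\<sigma> c"])
    show "regular_seq (\<lambda>j. v j ^ e j) (Suc (Suc q))" for e
      unfolding regular_seq_def
    proof (intro allI impI)
      fix r s assume r: "r < Suc (Suc q)" and "v r ^ e r * s \<in> gen_ideal (\<lambda>j. v j ^ e j) r"
      from \<tau>_gen[OF this(2)] have "var (h r) ^ e r * \<tau> s \<in> gen_ideal (\<lambda>j. var (h j) ^ e j) r"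
        by (simp add: \<tau>_hom v_def \<tau>\<sigma>)
      moreover have "inj_on h {..<Suc (Suc q)}" using h_inj by (simp add: lessThan_Suc_atMost)
      ultimately have "\<tau> s \<in> gen_ideal (\<lambda>j. var (h j) ^ e j) r"
        using regular_seq_monomials r unfolding regular_seq_def by blast
      from \<sigma>_gen[OF this] show "s \<in> gen_ideal (\<lambda>j. v j ^ e j) r" by (simp add: \<sigma>\<tau>)
    qed
    show "x \<in> ?T ?N" if x: "x \<in> C.ann (\<lambda>j. v j ^ e j) (Suc ?N) ?N" for e x
    proof -
      \<comment> \<open>A form of degree \<open>K\<close> in the \<open>y\<^sub>j\<close> lies in the ideal of their powers, and the change of coordinates preserves
        this degree.\<close>
      define K where "K = Suc (\<Sum>j<Suc ?N. e j)"
      have "s \<odot>\<^bsub>E ?N\<^esub> x = \<zero>\<^bsub>E ?N\<^esub>" if s: "s \<in> y_ideal [^]\<^bsub>ideals_set class_ring\<^esub> K" for s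
      proof -
        have "\<tau> s \<in> gen_ideal (\<lambda>j. var (h j) ^ e j) (Suc ?N)"
          unfolding gen_ideal_monomials
        proof
          fix t assume "t \<in> Poly_Mapping.keys (\<tau> s)"
          then obtain t' where "t' \<in> Poly_Mapping.keys s" "vdeg (range Inr) t = vdeg (range Inr) t'"
            using \<tau>_homog by blast
          with y_ideal_power_vdeg[OF s] have "K \<le> vdeg (h ` {..?N}) t" by (simp add: h_img)
          also have "\<dots> = (\<Sum>j<Suc ?N. Poly_Mapping.lookup t (h j))"
            unfolding P.vdeg_h by simp
          finally have "\<exists>i<Suc ?N. e i < Poly_Mapping.lookup t (h i)"
            unfolding K_def by (intro sum_pigeonhole) simp
          thus "\<exists>i<Suc ?N. e i \<le> Poly_Mapping.lookup t (h i)" using less_imp_le by blast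
        qed
        from C.ann_gen_ideal[OF x \<sigma>_gen[OF this]] show ?thesis by (simp add: \<sigma>\<tau>)
      qed
      thus ?thesis using C.ann_carrier[OF x] unfolding torsion_def by blast
    qed
    show "\<exists>l. x \<in> C.ann (\<lambda>j. v j ^ l) (Suc q) q" if "x \<in> ?T q" for x
    proof -
      from that obtain l where "x \<in> carrier (E q)"
        "\<And>s. s \<in> y_ideal [^]\<^bsub>ideals_set class_ring\<^esub> (l::nat) \<Longrightarrow> s \<odot>\<^bsub>E q\<^esub> x = \<zero>\<^bsub>E q\<^esub>"
        unfolding torsion_def by blast
      thus ?thesis using power_in_ideal_power[OF y_ideal_ideal v_Q] unfolding C.ann_def by blast
    qed
    show "v ?N ^ M * \<sigma> g - \<sigma> c * f \<in> gen_ideal (\<lambda>j. v j ^ Suc k) (Suc q)"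
      using \<sigma>_gen[OF g(3)] by (simp only: \<sigma>_hom \<sigma>\<tau> v_def)
  qed (rule k)
  then obtain l c' where "v 0 ^ k * \<sigma> g * (\<Prod>j<?N. v j ^ l) - c' * f \<in> gen_ideal (\<lambda>j. v j ^ (l + Suc k)) ?N"
    by blast
  from \<tau>_gen[OF this] have
    "var (h 0) ^ k * g * (\<Prod>j<?N. var (h j) ^ l) - \<tau> c' * \<tau> f \<in> gen_ideal (\<lambda>j. var (h j) ^ (l + Suc k)) ?N"
    by (simp only: \<tau>_hom v_def \<tau>\<sigma>)
  with P.monomial_multiple_not_in_ideal[OF g(1,2)] show False by blast
qed

end
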